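(* Assume the Quantitative Hardy--Littlewood prime tuples conjecture (stated in the context). Then the series $\sum_{n=2}^\infty \frac{(-1)^{\pi(n)}}{n \log n}$ converges, and the series $\sum_{n=1}^\infty \frac{(-1)^n n}{p_n}$ converges.
   Context: $p_n$ denotes the $n$-th prime, $\mathcal{P}$ the set of primes, $1_{\mathcal{P}}$ its indicator function, and $\pi(x) = \#\{p \le x : p \text{ prime}\}$. For a finite set $\mathcal{H}$ of $k$ integers, $\nu_{\mathcal{H}}(p)$ is the number of distinct residue classes modulo $p$ occupied by $\mathcal{H}$, and the singular series is $\mathfrak{S}(\mathcal{H}) = \prod_p \frac{1-\nu_{\mathcal{H}}(p)/p}{(1-1/p)^k}$. Quantitative Hardy--Littlewood prime tuples conjecture: there exist absolute constants $\varepsilon>0$ and $C>0$ such that for all $x \ge 10$, all $k \le (\log\log x)^5$, and all sets $\mathcal{H}=\{h_1,\dots,h_k\} \subset [0,\log^2 x]$ of distinct integers, one has $\left|\sum_{n\le x} 1_{\mathcal{P}}(n+h_1)\cdots 1_{\mathcal{P}}(n+h_k) - \mathfrak{S}(\mathcal{H}) \int_2^x \frac{dy}{\log^k y}\right| \le C x^{1-\varepsilon}$. *)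

theory Defs
  imports "HOL-Analysis.Analysis" "HOL-Computational_Algebra.Primes" "HOL-Library.Infinite_Set"
begin

definition prime_pi :: "real \<Rightarrow> nat" where
  "prime_pi x = card {p::nat. prime p \<and> real p \<le> x}"

(* One-based: nth_prime 1 = 2; the value at 0 is not meaningful. *)
definition nth_prime :: "nat \<Rightarrow> nat" where
  "nth_prime n = enumerate {p::nat. prime p} (n - 1)"

definition residue_count :: "int set \<Rightarrow> nat \<Rightarrow> nat" where
  "residue_count H p = card ((\<lambda>h. h mod int p) ` H)"

(* The product over primes is an infinite product over the naturals with factor 1 at non-primes.
   The library's prodinf admits finitely many zero factors, so it is 0 for inadmissible H. *)
definition singular_series :: "int set \<Rightarrow> real" where
  "singular_series H =
     prodinf (\<lambda>p. if prime p
                  then (1 - real (residue_count H p) / real p) / (1 - 1 / real p) ^ card H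
                  else 1)"

definition quantitative_Hardy_Littlewood :: bool where
  "quantitative_Hardy_Littlewood \<longleftrightarrow>
     (\<exists>\<epsilon>>0. \<exists>C>0. \<forall>x\<ge>10. \<forall>k::nat. \<forall>H::int set.
        real k \<le> (ln (ln x)) ^ 5 \<longrightarrow>
        finite H \<longrightarrow> card H = k \<longrightarrow> (\<forall>h\<in>H. 0 \<le> h \<and> real_of_int h \<le> (ln x)\<^sup>2) \<longrightarrow>
        \<bar>(\<Sum>n\<in>{1..\<lfloor>x\<rfloor>}. \<Prod>h\<in>H. indicat_real {p::int. prime p} (n + h))
           - singular_series H * integral {2..x} (\<lambda>y. 1 / (ln y) ^ k)\<bar>
        \<le> C * x powr (1 - \<epsilon>))"

end

theory Submission
  imports Defs "HOL-Real_Asymp.Real_Asymp"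
begin

text \<open>
  Let \<open>s(n) = (-1)^\<pi>(n)\<close>. Everything rests on the bound \<open>\<Sum>\<^sub>n\<^sub>\<le>\<^sub>x s(n) = O(x (log log x)^(-5/4))\<close>, since partial
  summation then gives the first series, and the second one reduces to it: summation by parts over the
  gaps between primes turns \<open>\<Sum> (-1)^n n / p\<^sub>n\<close> into \<open>\<Sum> s(m) \<pi>(m) / (m (m + 1))\<close> up to an alternating series,
  and the prime number theorem with error term is the case \<open>k = 1\<close> of the conjecture.

  By van der Corput's inequality the bound follows from estimates for the correlations
  \<open>\<Sum>\<^sub>n\<^sub>\<le>\<^sub>x s(n) s(n + h)\<close> with \<open>h\<close> up to \<open>log x (log log x)^3\<close>. As \<open>s(n) s(n + h) = (1 - 2)^N\<close>, where \<open>N\<close> is the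
  number of primes in \<open>(n, n + h]\<close>, expanding binomially up to order \<open>(log log x)^5\<close> and applying the
  conjecture gives the main term \<open>\<Sum>\<^sub>k \<Sum>\<^sub>H (-2 / log y)^k \<SS>(H)\<close>, integrated over \<open>y\<close>. If the primes below \<open>P\<close> have
  \<open>\<Prod> (1 - 1/p)\<close> close to \<open>2 / log y\<close>, then \<open>(2 / log y)^k \<SS>(H)\<close> is nearly the probability that \<open>H\<close> survives
  the removal of one random residue class modulo every prime up to \<open>P\<close>. The main term is therefore nearly
  the probability that no element of \<open>{1..h}\<close> survives, and since the variance of the number of survivors is
  at most its mean, this is at most \<open>log y / (2 h)\<close>.
\<close>

section \<open>The random sieve\<close>

text \<open>A weighted Bonferroni inequality. By Pascal's rule the remainder at
  \<open>(Suc N, Suc J)\<close> is the one at \<open>(N, Suc J)\<close> minus \<open>t\<close> times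
  the one at \<open>(N, J)\<close>, and the bounds add up by the same rule; \<open>t <= 2\<close>
  enters at \<open>K = 0\<close>, through \<open>\<bar>1 - t\<bar> \<le> 1\<close>. It is used with
  \<open>t = 2\<close> for the parity and with \<open>t = 1\<close> for inclusion-exclusion.\<close>

lemma truncated_binomial_bound:
  fixes t :: real
  assumes "0 \<le> t" "t \<le> 2"
  shows "\<bar>(1 - t) ^ N - (\<Sum>k<K. (- t) ^ k * real (N choose k))\<bar> \<le> t ^ K * real (N choose K)"
proof (induction N arbitrary: K)
  case 0
  show ?case
  proof (cases K)
    case (Suc J)
    have "(\<Sum>k<Suc J. (- t) ^ k * real (0 choose k)) = 1"
      by (subst sum.lessThan_Suc_shift) simp
    then show ?thesis by (simp add: Suc)
  qed simp
next
  case (Suc N)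
  show ?case
  proof (cases K)
    case 0
    have "\<bar>1 - t\<bar> ^ Suc N \<le> 1" using assms by (intro power_le_one) auto
    then show ?thesis by (simp add: 0 power_abs[symmetric] abs_mult)
  next
    case K: (Suc J)
    let ?P = "\<lambda>N K. (\<Sum>k<K. (- t) ^ k * real (N choose k))"
    have "?P (Suc N) (Suc J) = 1 + (\<Sum>k<J. (- t) ^ Suc k * real (Suc N choose Suc k))"
      by (subst sum.lessThan_Suc_shift) simp
    also have "\<dots> = (1 + (\<Sum>k<J. (- t) ^ Suc k * real (N choose Suc k))) - t * ?P N J"
      by (simp add: sum_distrib_left algebra_simps sum.distrib sum_negf sum_subtractf)
    also have "1 + (\<Sum>k<J. (- t) ^ Suc k * real (N choose Suc k)) = ?P N (Suc J)"
      by (simp only: sum.lessThan_Suc_shift) simp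
    finally have eq: "(1 - t) ^ Suc N - ?P (Suc N) (Suc J)
        = ((1 - t) ^ N - ?P N (Suc J)) - t * ((1 - t) ^ N - ?P N J)"
      by (simp add: algebra_simps)
    have "\<bar>(1 - t) ^ Suc N - ?P (Suc N) (Suc J)\<bar>
        \<le> \<bar>(1 - t) ^ N - ?P N (Suc J)\<bar> + t * \<bar>(1 - t) ^ N - ?P N J\<bar>"
      unfolding eq using assms(1)
        abs_triangle_ineq4[of "(1 - t) ^ N - ?P N (Suc J)" "t * ((1 - t) ^ N - ?P N J)"]
      by (simp only: abs_mult abs_of_nonneg)
    also have "\<dots> \<le> t ^ Suc J * real (N choose Suc J) + t * (t ^ J * real (N choose J))"
      using Suc.IH[of "Suc J"] Suc.IH[of J] assms(1) by (intro add_mono mult_left_mono) auto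
    also have "\<dots> = t ^ Suc J * real (Suc N choose Suc J)" by (simp add: algebra_simps)
    finally show ?thesis by (simp add: K)
  qed
qed


section \<open>Sifting an interval by one random residue class per prime\<close>

definition primes_upto :: "nat \<Rightarrow> nat set" where
  "primes_upto M = {p. prime p \<and> p \<le> M}"

definition sieve_density :: "nat \<Rightarrow> real" where
  "sieve_density M = (\<Prod>p\<in>primes_upto M. 1 - 1 / real p)"

text \<open>The probability that all of \<open>H\<close> survives when one residue class modulo each
  prime up to \<open>M\<close>, chosen uniformly and independently, is removed.\<close>

definition tuple_density :: "nat \<Rightarrow> int set \<Rightarrow> real" where
  "tuple_density M H = (\<Prod>p\<in>primes_upto M. 1 - real (residue_count H p) / real p)"

definition k_subsets :: "nat \<Rightarrow> nat \<Rightarrow> int set set" where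
  "k_subsets h k = {H. H \<subseteq> {1..int h} \<and> card H = k}"

definition residue_choices :: "nat \<Rightarrow> (nat \<Rightarrow> int) set" where
  "residue_choices M = PiE (primes_upto M) (\<lambda>p. {0..<int p})"

definition survivors :: "nat \<Rightarrow> nat \<Rightarrow> (nat \<Rightarrow> int) \<Rightarrow> int set" where
  "survivors M h a = {m \<in> {1..int h}. \<forall>p\<in>primes_upto M. m mod int p \<noteq> a p}"

lemma finite_primes_upto [simp]: "finite (primes_upto M)"
  by (rule finite_subset[of _ "{..M}"]) (auto simp: primes_upto_def)

lemma primes_uptoD: "p \<in> primes_upto M \<Longrightarrow> prime p \<and> 2 \<le> p \<and> p \<le> M"
  by (auto simp: primes_upto_def prime_ge_2_nat)

lemma finite_k_subsets [simp]: "finite (k_subsets h k)"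
  by (rule finite_subset[of _ "Pow {1..int h}"]) (auto simp: k_subsets_def)

lemma k_subsetsD: "H \<in> k_subsets h k \<Longrightarrow> finite H \<and> H \<subseteq> {1..int h} \<and> card H = k"
  by (auto simp: k_subsets_def intro: finite_subset)

lemma card_k_subsets: "card (k_subsets h k) = h choose k"
  by (simp add: k_subsets_def n_subsets)

lemma finite_survivors [simp]: "finite (survivors M h a)"
  by (rule finite_subset[of _ "{1..int h}"]) (auto simp: survivors_def)

lemma finite_residue_choices [simp]: "finite (residue_choices M)"
  by (auto simp: residue_choices_def intro!: finite_PiE)

lemma card_residue_choices_pos: "card (residue_choices M) > 0"
  by (auto simp: residue_choices_def card_PiE intro!: prod_pos dest: primes_uptoD)

lemma residue_count_le: "p > 0 \<Longrightarrow> residue_count H p \<le> p"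
proof -
  assume "p > 0"
  then have "(\<lambda>h. h mod int p) ` H \<subseteq> {0..<int p}" by auto
  then have "card ((\<lambda>h. h mod int p) ` H) \<le> card {0..<int p}" by (intro card_mono) auto
  then show ?thesis by (simp add: residue_count_def)
qed

lemma tuple_factor_bounds:
  assumes "p > 0"
  shows "0 \<le> 1 - real (residue_count H p) / real p" "1 - real (residue_count H p) / real p \<le> 1"
  using residue_count_le[OF assms, of H] assms by (auto simp: field_simps)

lemma tuple_density_nonneg: "0 \<le> tuple_density M H"
  unfolding tuple_density_def by (intro prod_nonneg ballI tuple_factor_bounds) (auto dest: primes_uptoD)

lemma tuple_density_le_1: "tuple_density M H \<le> 1"
  unfolding tuple_density_def by (intro prod_le_1 conjI tuple_factor_bounds) (auto dest: primes_uptoD)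

text \<open>The condition on \<open>a\<close> splits over the primes, so its indicator is a product
  over \<open>p\<close> and the count a product of counts: \<open>p - residue_count H p\<close>
  classes modulo \<open>p\<close> avoid \<open>H\<close>.\<close>

lemma card_sifting_choices:
  "real (card {a \<in> residue_choices M. \<forall>p\<in>primes_upto M. \<forall>m\<in>H. m mod int p \<noteq> a p})
   = real (card (residue_choices M)) * tuple_density M H"
proof -
  let ?g = "\<lambda>p (r::int). if r \<in> (\<lambda>h. h mod int p) ` H then 0 else (1::real)"
  have "real (card {a \<in> residue_choices M. \<forall>p\<in>primes_upto M. \<forall>m\<in>H. m mod int p \<noteq> a p})
      = (\<Sum>a\<in>residue_choices M. if \<forall>p\<in>primes_upto M. \<forall>m\<in>H. m mod int p \<noteq> a p then 1 else 0)"
    by (simp add: sum.If_cases Int_def)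
  also have "\<dots> = (\<Sum>a\<in>residue_choices M. \<Prod>p\<in>primes_upto M. ?g p (a p))"
  proof (intro sum.cong refl)
    fix a
    show "(if \<forall>p\<in>primes_upto M. \<forall>m\<in>H. m mod int p \<noteq> a p then 1 else 0) = (\<Prod>p\<in>primes_upto M. ?g p (a p))"
    proof (cases "\<forall>p\<in>primes_upto M. \<forall>m\<in>H. m mod int p \<noteq> a p")
      case True
      then have "(\<Prod>p\<in>primes_upto M. ?g p (a p)) = (\<Prod>p\<in>primes_upto M. 1)"
        by (intro prod.cong) fastforce+
      with True show ?thesis by simp
    next
      case False
      then obtain p m where "p \<in> primes_upto M" "m \<in> H" "m mod int p = a p" by blast
      then have "(\<Prod>p\<in>primes_upto M. ?g p (a p)) = 0" by (intro prod_zero) force+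
      with False show ?thesis by (simp only: if_False)
    qed
  qed
  also have "\<dots> = (\<Prod>p\<in>primes_upto M. \<Sum>r\<in>{0..<int p}. ?g p r)"
    unfolding residue_choices_def by (rule prod_sum_PiE[symmetric]) auto
  also have "\<dots> = (\<Prod>p\<in>primes_upto M. real p * (1 - real (residue_count H p) / real p))"
  proof (rule prod.cong[OF refl])
    fix p assume "p \<in> primes_upto M"
    then have p: "p > 0" by (auto dest: primes_uptoD)
    let ?R = "(\<lambda>h. h mod int p) ` H"
    have sub: "?R \<subseteq> {0..<int p}" using p by auto
    have "(\<Sum>r\<in>{0..<int p}. ?g p r) = real (card ({0..<int p} - ?R))"
      by (simp add: sum.If_cases Diff_eq)
    also have "\<dots> = real p - real (residue_count H p)"
      using sub residue_count_le[OF p, of H] finite_subset[OF sub]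
      by (simp add: card_Diff_subset residue_count_def)
    finally show "(\<Sum>r\<in>{0..<int p}. ?g p r) = real p * (1 - real (residue_count H p) / real p)"
      using p by (simp add: right_diff_distrib)
  qed
  also have "\<dots> = real (card (residue_choices M)) * tuple_density M H"
    by (simp add: prod.distrib tuple_density_def residue_choices_def card_PiE)
  finally show ?thesis .
qed

lemma card_survivors_superset:
  assumes "H \<subseteq> {1..int h}"
  shows "real (card {a \<in> residue_choices M. H \<subseteq> survivors M h a})
   = real (card (residue_choices M)) * tuple_density M H"
proof -
  have "{a \<in> residue_choices M. H \<subseteq> survivors M h a}
      = {a \<in> residue_choices M. \<forall>p\<in>primes_upto M. \<forall>m\<in>H. m mod int p \<noteq> a p}"
    using assms by (auto simp: survivors_def)
  then show ?thesis by (simp only: card_sifting_choices)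
qed

text \<open>Double counting of the pairs of a choice \<open>a\<close> and a \<open>k\<close>-set of
  survivors: the sieve probabilities summed over \<open>k\<close>-sets are the binomial moments of
  the number of survivors.\<close>

lemma sum_choose_survivors:
  "(\<Sum>a\<in>residue_choices M. real (card (survivors M h a) choose k))
   = real (card (residue_choices M)) * (\<Sum>H\<in>k_subsets h k. tuple_density M H)"
proof -
  have "(\<Sum>a\<in>residue_choices M. real (card (survivors M h a) choose k))
      = (\<Sum>a\<in>residue_choices M. \<Sum>H\<in>k_subsets h k. if H \<subseteq> survivors M h a then 1 else 0)"
  proof (intro sum.cong refl)
    fix a
    have "{H. H \<subseteq> survivors M h a \<and> card H = k} = {H \<in> k_subsets h k. H \<subseteq> survivors M h a}"
      by (auto simp: k_subsets_def survivors_def)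
    then have "real (card (survivors M h a) choose k) = real (card {H \<in> k_subsets h k. H \<subseteq> survivors M h a})"
      using n_subsets[OF finite_survivors, of M h a k] by metis
    then show "real (card (survivors M h a) choose k)
        = (\<Sum>H\<in>k_subsets h k. if H \<subseteq> survivors M h a then 1 else 0)"
      by (simp add: sum.If_cases Int_def)
  qed
  also have "\<dots> = (\<Sum>H\<in>k_subsets h k. \<Sum>a\<in>residue_choices M. if H \<subseteq> survivors M h a then 1 else 0)"
    by (rule sum.swap)
  also have "\<dots> = (\<Sum>H\<in>k_subsets h k. real (card (residue_choices M)) * tuple_density M H)"
  proof (rule sum.cong[OF refl])
    fix H assume "H \<in> k_subsets h k"
    then have "H \<subseteq> {1..int h}" by (simp add: k_subsetsD)
    have "(\<Sum>a\<in>residue_choices M. if H \<subseteq> survivors M h a then 1 else 0)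
        = real (card {a \<in> residue_choices M. H \<subseteq> survivors M h a})"
      by (simp add: sum.If_cases Int_def)
    then show "(\<Sum>a\<in>residue_choices M. if H \<subseteq> survivors M h a then 1 else 0)
        = real (card (residue_choices M)) * tuple_density M H"
      using card_survivors_superset[OF \<open>H \<subseteq> _\<close>] by simp
  qed
  finally show ?thesis by (simp add: sum_distrib_left)
qed

lemma prime_divisor_set_prod_dvd:
  fixes d :: nat
  assumes "finite U" "\<And>p. p \<in> U \<Longrightarrow> prime p" "\<And>p. p \<in> U \<Longrightarrow> p dvd d"
  shows "\<Prod>U dvd d"
  using assms
proof (induction U rule: finite_induct)
  case (insert p U)
  have "coprime p (\<Prod>U)"
    using insert by (intro prod_coprime_right) (auto intro!: primes_coprime)
  with insert show ?case by (auto intro: divides_mult)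
qed auto

lemma card_multiples_le:
  assumes "q > 0"
  shows "real (card {d \<in> {1..D}. q dvd d}) \<le> real D / real q"
proof -
  have "{d \<in> {1..D}. q dvd d} \<subseteq> (\<lambda>j. q * j) ` {1..D div q}"
  proof
    fix d assume "d \<in> {d \<in> {1..D}. q dvd d}"
    then obtain j where j: "d = q * j" "1 \<le> d" "d \<le> D" by auto
    then have "j \<le> D div q" "1 \<le> j" using assms
      by (auto simp: less_eq_div_iff_mult_less_eq mult.commute Suc_le_eq)
    then show "d \<in> (\<lambda>j. q * j) ` {1..D div q}" using j by auto
  qed
  then have "card {d \<in> {1..D}. q dvd d} \<le> card {1..D div q}"
    by (meson card_image_le card_mono finite_atLeastAtMost finite_imageI le_trans)
  then have "real (card {d \<in> {1..D}. q dvd d}) \<le> real (D div q)" by simp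
  also have "\<dots> \<le> real D / real q" using assms
    by (simp add: le_divide_eq flip: of_nat_mult)
  finally show ?thesis .
qed

lemma residue_count_pair:
  assumes "p > 0" "a < b"
  shows "residue_count {int a, int b} p = (if p dvd (b - a) then 1 else 2)"
proof -
  have "int a mod int p = int b mod int p \<longleftrightarrow> p dvd (b - a)"
    using assms by (metis less_imp_le_nat mod_eq_dvd_iff_nat nat_int_comparison(1) of_nat_mod)
  then show ?thesis by (auto simp: residue_count_def)
qed

text \<open>The pair density expands into nonnegative multiples of indicators of divisibility,
  so bounding each count of multiples by its expected value loses nothing.\<close>

lemma sum_pair_density_le:
  "(\<Sum>d=1..D. \<Prod>p\<in>primes_upto M. 1 - (if p dvd d then 1 else 2) / real p) \<le> real D * sieve_density M ^ 2"
proof -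
  let ?P = "primes_upto M"
  let ?c = "\<lambda>U. (\<Prod>p\<in>U. 1 / real p) * (\<Prod>p\<in>?P - U. 1 - 2 / real p)"
  have c_nonneg: "?c U \<ge> 0" for U
    by (intro mult_nonneg_nonneg prod_nonneg) (auto simp: field_simps dest: primes_uptoD)
  \<comment> \<open>Each factor is \<open>1 - 2 / p\<close>, plus \<open>1 / p\<close> if
    \<open>p\<close> divides \<open>d\<close>. Multiplying out gives one term for each set
    \<open>U\<close> of primes, which vanishes unless the product of \<open>U\<close> divides
    \<open>d\<close>.\<close>
  have "(\<Sum>d=1..D. \<Prod>p\<in>?P. 1 - (if p dvd d then 1 else 2) / real p)
      = (\<Sum>d=1..D. \<Prod>p\<in>?P. (if p dvd d then 1 / real p else 0) + (1 - 2 / real p))"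
    by (intro sum.cong prod.cong refl) (auto simp: field_simps)
  also have "\<dots> = (\<Sum>d=1..D. \<Sum>U\<in>Pow ?P. (\<Prod>p\<in>U. if p dvd d then 1 / real p else 0) * (\<Prod>p\<in>?P - U. 1 - 2 / real p))"
    by (simp add: prod_add)
  also have "\<dots> \<le> (\<Sum>d=1..D. \<Sum>U\<in>Pow ?P. (if \<Prod>U dvd d then 1 else 0) * ?c U)"
  proof (intro sum_mono)
    fix d U assume U: "U \<in> Pow ?P"
    show "(\<Prod>p\<in>U. if p dvd d then 1 / real p else 0) * (\<Prod>p\<in>?P - U. 1 - 2 / real p)
        \<le> (if \<Prod>U dvd d then 1 else 0) * ?c U"
    proof (cases "\<forall>p\<in>U. p dvd d")
      case True
      moreover from True U have "\<Prod>U dvd d"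
        by (intro prime_divisor_set_prod_dvd) (auto intro: finite_subset dest: primes_uptoD)
      ultimately show ?thesis by simp
    next
      case False
      then obtain q where "q \<in> U" "\<not> q dvd d" by blast
      moreover have "finite U" using U by (auto intro: finite_subset)
      ultimately have "(\<Prod>p\<in>U. if p dvd d then 1 / real p else 0) = 0"
        by (intro prod_zero) auto
      then show ?thesis using c_nonneg[of U] by simp
    qed
  qed
  also have "\<dots> = (\<Sum>U\<in>Pow ?P. real (card {d \<in> {1..D}. \<Prod>U dvd d}) * ?c U)"
    by (subst sum.swap) (simp add: sum_distrib_right[symmetric] sum.If_cases Int_def)
  also have "\<dots> \<le> (\<Sum>U\<in>Pow ?P. (real D / real (\<Prod>U)) * ?c U)"
  proof (intro sum_mono mult_right_mono c_nonneg card_multiples_le)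
    fix U assume "U \<in> Pow ?P"
    then show "\<Prod>U > 0" by (intro prod_pos) (force dest: primes_uptoD)
  qed
  also have "\<dots> = real D * (\<Sum>U\<in>Pow ?P. (\<Prod>p\<in>U. 1 / real p ^ 2) * (\<Prod>p\<in>?P - U. 1 - 2 / real p))"
    by (simp add: sum_distrib_left prod_dividef power2_eq_square prod.distrib field_simps)
  also have "\<dots> = real D * (\<Prod>p\<in>?P. 1 / real p ^ 2 + (1 - 2 / real p))"
    by (simp add: prod_add)
  \<comment> \<open>Each local factor is \<open>(1 - 1 / p)^2\<close>: on average over the
    difference, a pair is no likelier to survive than two independent points.\<close>
  also have "(\<Prod>p\<in>?P. 1 / real p ^ 2 + (1 - 2 / real p)) = sieve_density M ^ 2"
    unfolding sieve_density_def prod_power_distrib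
    by (intro prod.cong refl) (auto simp: power2_eq_square field_simps dest: primes_uptoD)
  finally show ?thesis .
qed

lemma tuple_density_singleton: "tuple_density M {a} = sieve_density M"
  by (simp add: tuple_density_def sieve_density_def residue_count_def)

lemma sieve_density_pos: "sieve_density M > 0"
  unfolding sieve_density_def by (intro prod_pos) (auto simp: field_simps dest: primes_uptoD)

lemma sum_triangle_swap:
  fixes f :: "nat \<Rightarrow> real"
  shows "(\<Sum>b=1..h. \<Sum>a\<in>{1..<b}. f (b - a)) = (\<Sum>b=1..h. \<Sum>d=1..b-1. f d)"
proof (rule sum.cong[OF refl])
  fix b :: nat
  show "(\<Sum>a\<in>{1..<b}. f (b - a)) = (\<Sum>d=1..b-1. f d)"
    by (rule sum.reindex_bij_witness[of _ "\<lambda>d. b - d" "\<lambda>d. b - d"]) auto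
qed

lemma k_subsets_2:
  "k_subsets h 2 = (\<lambda>(b, a). {int a, int b}) ` (SIGMA b:{1..h}. {1..<b})"
proof (intro equalityI subsetI)
  fix H assume "H \<in> k_subsets h 2"
  then have H: "H \<subseteq> {1..int h}" "card H = 2" by (auto simp: k_subsets_def)
  then obtain u v where uv: "H = {u, v}" "u < v"
    by (metis card_2_iff insert_commute linorder_neqE)
  then have "nat u \<in> {1..<nat v}" "nat v \<in> {1..h}" "H = {int (nat u), int (nat v)}"
    using H by auto
  then show "H \<in> (\<lambda>(b, a). {int a, int b}) ` (SIGMA b:{1..h}. {1..<b})"
    by (intro image_eqI[of _ _ "(nat v, nat u)"]) auto
qed (auto simp: k_subsets_def)

text \<open>With the larger element \<open>b\<close> fixed, the differences \<open>b - a\<close>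
  fill the initial segment \<open>{1..b-1}\<close>, so the averaged pair bound applies for each
  \<open>b\<close>.\<close>

lemma sum_tuple_density_pairs_le:
  "(\<Sum>H\<in>k_subsets h 2. tuple_density M H) \<le> real h ^ 2 * sieve_density M ^ 2 / 2"
proof -
  let ?s = "sieve_density M"
  let ?w = "\<lambda>d. \<Prod>p\<in>primes_upto M. 1 - (if p dvd d then 1 else 2) / real p"
  have inj: "inj_on (\<lambda>(b, a). {int a, int b}) (SIGMA b:{1..h}. {1..<b})"
    by (auto simp: inj_on_def doubleton_eq_iff)
  have "(\<Sum>H\<in>k_subsets h 2. tuple_density M H)
      = (\<Sum>(b, a)\<in>(SIGMA b:{1..h}. {1..<b}). tuple_density M {int a, int b})"
    unfolding k_subsets_2 by (subst sum.reindex[OF inj]) (simp add: case_prod_unfold)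
  also have "\<dots> = (\<Sum>b=1..h. \<Sum>a\<in>{1..<b}. tuple_density M {int a, int b})"
    by (rule sum.Sigma[symmetric]) auto
  also have "\<dots> = (\<Sum>b=1..h. \<Sum>a\<in>{1..<b}. ?w (b - a))"
    unfolding tuple_density_def
    by (intro sum.cong prod.cong refl) (auto simp: residue_count_pair dest: primes_uptoD)
  also have "\<dots> = (\<Sum>b=1..h. \<Sum>d=1..b-1. ?w d)" by (rule sum_triangle_swap)
  also have "\<dots> \<le> (\<Sum>b=1..h. real (b - 1) * ?s ^ 2)" by (intro sum_mono sum_pair_density_le)
  also have "\<dots> = (\<Sum>b=1..h. real (b - 1)) * ?s ^ 2" by (rule sum_distrib_right[symmetric])
  also have "(\<Sum>b=1..h. real (b - 1)) \<le> real h ^ 2 / 2"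
    by (induction h) (auto simp: power2_eq_square field_simps)
  finally show ?thesis by (simp add: mult_right_mono)
qed

text \<open>Chebyshev's inequality: the variance of the number of survivors is at most its mean.\<close>

lemma card_no_survivors_le:
  assumes "h > 0"
  shows "real (card {a \<in> residue_choices M. survivors M h a = {}})
    \<le> real (card (residue_choices M)) / (real h * sieve_density M)"
proof -
  let ?R = "residue_choices M" and ?s = "sieve_density M"
  let ?N = "\<lambda>a. real (card (survivors M h a))"
  define \<mu> where "\<mu> = real h * ?s"
  have \<mu>: "\<mu> > 0" using assms by (simp add: \<mu>_def sieve_density_pos)
  have k1: "k_subsets h 1 = (\<lambda>a. {a}) ` {1..int h}" by (auto simp: k_subsets_def card_1_singleton_iff)
  have m1: "(\<Sum>a\<in>?R. ?N a) = real (card ?R) * \<mu>"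
    using sum_choose_survivors[of M h 1] unfolding k1
    by (simp add: sum.reindex tuple_density_singleton \<mu>_def)
  \<comment> \<open>Twice the second binomial moment is the sum of \<open>N^2 - N\<close>, which the
    pair bound controls.\<close>
  have "real (n choose 2) * 2 = real n * real n - real n" for n :: nat
    by (induction n) (auto simp: numeral_2_eq_2 field_simps)
  then have "(\<Sum>a\<in>?R. ?N a * ?N a - ?N a) = (\<Sum>a\<in>?R. real (card (survivors M h a) choose 2)) * 2"
    by (simp add: sum_distrib_right)
  also have "\<dots> \<le> real (card ?R) * \<mu> ^ 2"
    using sum_tuple_density_pairs_le[of M h] card_residue_choices_pos[of M]
    by (simp add: sum_choose_survivors \<mu>_def power_mult_distrib mult_left_mono)
  finally have m2: "(\<Sum>a\<in>?R. ?N a * ?N a - ?N a) \<le> real (card ?R) * \<mu> ^ 2" .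
  have "(\<Sum>a\<in>?R. (?N a - \<mu>) ^ 2)
      = (\<Sum>a\<in>?R. ?N a * ?N a - ?N a) + (1 - 2 * \<mu>) * (\<Sum>a\<in>?R. ?N a) + real (card ?R) * \<mu> ^ 2"
    by (simp add: power2_eq_square algebra_simps sum.distrib sum_subtractf sum_distrib_left)
  also have "\<dots> \<le> real (card ?R) * \<mu>"
    using m2 unfolding m1 by (simp add: algebra_simps power2_eq_square)
  finally have var: "(\<Sum>a\<in>?R. (?N a - \<mu>) ^ 2) \<le> real (card ?R) * \<mu>" .
  \<comment> \<open>Every choice without survivors contributes exactly \<open>\<mu> ^ 2\<close> to
    the sum of squared deviations.\<close>
  have "real (card {a \<in> ?R. survivors M h a = {}}) * \<mu> ^ 2
      = (\<Sum>a\<in>{a \<in> ?R. survivors M h a = {}}. (?N a - \<mu>) ^ 2)" by simp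
  also have "\<dots> \<le> (\<Sum>a\<in>?R. (?N a - \<mu>) ^ 2)" by (intro sum_mono2) auto
  also note var
  finally show ?thesis using \<mu> by (simp add: \<mu>_def[symmetric] field_simps power2_eq_square)
qed

text \<open>Averages the truncated expansion of \<open>(1 - 1) ^ N\<close> over all choices, where
  \<open>N\<close> is the number of survivors. The term \<open>0 ^ N\<close> becomes the probability
  that nothing survives, bounded by Chebyshev, and the truncation error becomes the
  \<open>K\<close>-th binomial moment.\<close>

lemma alternating_tuple_density_bound:
  assumes "h > 0"
  shows "\<bar>\<Sum>k<K. (- 1) ^ k * (\<Sum>H\<in>k_subsets h k. tuple_density M H)\<bar>
    \<le> 1 / (real h * sieve_density M) + (\<Sum>H\<in>k_subsets h K. tuple_density M H)"
proof -
  let ?R = "residue_choices M"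
  let ?N = "\<lambda>a. card (survivors M h a)"
  let ?V = "\<lambda>k. \<Sum>H\<in>k_subsets h k. tuple_density M H"
  define c where "c = real (card ?R)"
  have c: "c > 0" using card_residue_choices_pos[of M] by (simp add: c_def)
  have "c * (\<Sum>k<K. (- 1) ^ k * ?V k) = (\<Sum>k<K. (- 1) ^ k * (\<Sum>a\<in>?R. real (?N a choose k)))"
    by (simp add: sum_choose_survivors c_def sum_distrib_left mult_ac)
  also have "\<dots> = (\<Sum>a\<in>?R. \<Sum>k<K. (- 1) ^ k * real (?N a choose k))"
    by (subst sum.swap) (simp add: sum_distrib_left)
  finally have eq: "c * (\<Sum>k<K. (- 1) ^ k * ?V k) = (\<Sum>a\<in>?R. \<Sum>k<K. (- 1) ^ k * real (?N a choose k))" .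
  have "\<bar>c * (\<Sum>k<K. (- 1) ^ k * ?V k)\<bar> \<le> (\<Sum>a\<in>?R. \<bar>\<Sum>k<K. (- 1) ^ k * real (?N a choose k)\<bar>)"
    unfolding eq by (rule sum_abs)
  also have "\<dots> \<le> (\<Sum>a\<in>?R. 0 ^ ?N a + real (?N a choose K))"
  proof (rule sum_mono)
    fix a
    show "\<bar>\<Sum>k<K. (- 1) ^ k * real (?N a choose k)\<bar> \<le> 0 ^ ?N a + real (?N a choose K)"
      using truncated_binomial_bound[of 1 "?N a" K] zero_le_power[of "0::real" "?N a"]
      by (simp del: zero_le_power)
  qed
  also have "\<dots> = real (card {a \<in> ?R. survivors M h a = {}}) + c * ?V K"
    by (simp add: sum.distrib sum_choose_survivors c_def power_0_left sum.If_cases Int_def)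
  also have "\<dots> \<le> c / (real h * sieve_density M) + c * ?V K"
    using card_no_survivors_le[OF assms, of M] by (simp add: c_def)
  also have "\<dots> = c * (1 / (real h * sieve_density M) + ?V K)" by (simp add: algebra_simps)
  finally show ?thesis using c by (simp add: abs_mult)
qed

section \<open>Singular series and sieve densities\<close>

lemma residue_count_eq_card:
  assumes "H \<subseteq> {1..int h}" "h \<le> p"
  shows "residue_count H p = card H"
proof -
  have "inj_on (\<lambda>m. m mod int p) H"
  proof (rule inj_onI)
    fix a b assume ab: "a \<in> H" "b \<in> H" "a mod int p = b mod int p"
    then have "int p dvd a - b" by (simp add: mod_eq_dvd_iff)
    moreover have "\<bar>a - b\<bar> < int p" proof -
      have "1 \<le> a" "a \<le> int h" "1 \<le> b" "b \<le> int h" using ab(1,2) assms(1) by auto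
      then show ?thesis using assms(2) by linarith
    qed
    ultimately show "a = b" using zdvd_not_zless[of "\<bar>a - b\<bar>" "int p"] by force
  qed
  then show ?thesis by (simp add: residue_count_def card_image)
qed

text \<open>Put \<open>u = 1 / p\<close>. Bernoulli's inequality for \<open>(1 - u) ^ k\<close>
  gives the upper bound. The lower one comes from Bernoulli for \<open>(1 + u) ^ k\<close> and
  \<open>(1 - u) ^ k * (1 + u) ^ k = (1 - u^2) ^ k <= 1\<close>.\<close>

lemma local_factor_bounds:
  assumes "k \<le> p" "2 \<le> p"
  shows "(1 - real k / real p) / (1 - 1 / real p) ^ k \<le> 1"
    and "1 - real k ^ 2 / real p ^ 2 \<le> (1 - real k / real p) / (1 - 1 / real p) ^ k"
proof -
  define u where "u = 1 / real p"
  have u: "0 < u" "u \<le> 1/2" "real k * u \<le> 1" using assms by (auto simp: u_def field_simps)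
  have pos: "(1 - u) ^ k > 0" using u by simp
  have "1 - real k * u \<le> (1 - u) ^ k" using Bernoulli_inequality[of "- u" k] u by simp
  then show "(1 - real k / real p) / (1 - 1 / real p) ^ k \<le> 1"
    using pos by (simp add: u_def field_simps)
  have "1 + real k * u \<le> (1 + u) ^ k" using Bernoulli_inequality[of u k] u by simp
  then have "(1 - real k * u) * (1 + real k * u) * (1 - u) ^ k \<le> (1 - real k * u) * (1 + u) ^ k * (1 - u) ^ k"
    using u pos by (intro mult_right_mono mult_left_mono) auto
  also have "\<dots> = (1 - real k * u) * (1 - u * u) ^ k"
    by (simp add: power_mult_distrib[symmetric] algebra_simps)
  also have "\<dots> \<le> (1 - real k * u) * 1"
    using u by (intro mult_left_mono power_le_one) (auto intro: mult_le_one)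
  finally have "(1 - real k * u) * (1 + real k * u) \<le> (1 - real k * u) / (1 - u) ^ k"
    using pos by (simp only: pos_le_divide_eq mult_1_right)
  moreover have "(1 - real k * u) * (1 + real k * u) = 1 - real k ^ 2 / real p ^ 2"
    by (simp add: u_def power2_eq_square algebra_simps)
  ultimately show "1 - real k ^ 2 / real p ^ 2 \<le> (1 - real k / real p) / (1 - 1 / real p) ^ k"
    by (simp add: u_def)
qed

lemma prod_one_minus_ge:
  fixes a :: "'a \<Rightarrow> real"
  assumes "finite A" "\<And>i. i \<in> A \<Longrightarrow> 0 \<le> a i \<and> a i \<le> 1"
  shows "1 - sum a A \<le> (\<Prod>i\<in>A. 1 - a i)"
  using assms
proof (induction A rule: finite_induct)
  case (insert i A)
  let ?Q = "\<Prod>j\<in>A. 1 - a j"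
  have Q: "1 - sum a A \<le> ?Q" using insert by auto
  have Q1: "?Q \<le> 1" using insert by (intro prod_le_1) auto
  have "a i * ?Q \<le> a i * 1" using insert Q1 by (intro mult_left_mono) auto
  then show ?case using Q insert by (simp add: algebra_simps)
qed auto

lemma sum_inverse_squares_tail_le:
  assumes "P > 0" "P \<le> n"
  shows "(\<Sum>i\<in>{P<..n}. 1 / real i ^ 2) \<le> 1 / real P - 1 / real n"
  using assms(2)
proof (induction n rule: dec_induct)
  case (step n)
  have "{P<..Suc n} = insert (Suc n) {P<..n}" using step by auto
  then have "(\<Sum>i\<in>{P<..Suc n}. 1 / real i ^ 2) \<le> 1 / real (Suc n) ^ 2 + (1 / real P - 1 / real n)"
    using step by simp
  also have "1 / real (Suc n) ^ 2 \<le> 1 / real n - 1 / real (Suc n)"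
  proof -
    have n: "real n > 0" using step assms(1) by simp
    have "1 / real (Suc n) ^ 2 \<le> 1 / (real n * real (Suc n))"
      unfolding power2_eq_square using n by (intro divide_left_mono mult_right_mono) auto
    also have "\<dots> = 1 / real n - 1 / real (Suc n)" using n by (simp add: field_simps)
    finally show ?thesis .
  qed
  finally show ?case by simp
qed simp

definition singular_factor :: "int set \<Rightarrow> nat \<Rightarrow> real" where
  "singular_factor H p = (if prime p
     then (1 - real (residue_count H p) / real p) / (1 - 1 / real p) ^ card H else 1)"

lemma singular_series_eq: "singular_series H = prodinf (singular_factor H)"
  by (simp add: singular_series_def singular_factor_def[abs_def])

lemma card_subset_interval_le: "H \<subseteq> {1..int h} \<Longrightarrow> card H \<le> h"
  using card_mono[of "{1..int h}" H] by simp

lemma singular_factor_bounds: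
  assumes "H \<subseteq> {1..int h}" "h \<le> p"
  shows "singular_factor H p \<le> 1" "1 - real (card H) ^ 2 / real p ^ 2 \<le> singular_factor H p"
proof -
  have le: "card H \<le> p" using card_subset_interval_le[OF assms(1)] assms(2) by simp
  have eq: "singular_factor H p = (1 - real (card H) / real p) / (1 - 1 / real p) ^ card H" if "prime p"
    using that by (simp add: singular_factor_def residue_count_eq_card[OF assms])
  have "singular_factor H p \<le> 1 \<and> 1 - real (card H) ^ 2 / real p ^ 2 \<le> singular_factor H p"
  proof (cases "prime p")
    case True
    then show ?thesis unfolding eq[OF True] using local_factor_bounds[OF le] prime_ge_2_nat by blast
  qed (simp add: singular_factor_def)
  then show "singular_factor H p \<le> 1" "1 - real (card H) ^ 2 / real p ^ 2 \<le> singular_factor H p"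
    by blast+
qed

lemma singular_factor_nonneg: "singular_factor H p \<ge> 0"
proof (cases "prime p")
  case True
  then have "p \<ge> 2" by (rule prime_ge_2_nat)
  then show ?thesis using tuple_factor_bounds(1)[of p H] by (simp add: singular_factor_def field_simps)
qed (simp add: singular_factor_def)

text \<open>From \<open>h\<close> on the factors differ from 1 by at most
  \<open>(card H)^2 / p^2\<close>, so the product converges absolutely. A vanishing factor at a
  small prime does no harm: the partial products then tend to 0.\<close>

lemma singular_series_LIMSEQ:
  assumes "H \<subseteq> {1..int h}"
  shows "(\<lambda>n. \<Prod>i\<le>n. singular_factor H i) \<longlonglongrightarrow> singular_series H"
proof -
  have "summable (\<lambda>i. norm (singular_factor H i - 1))"
  proof (rule summable_comparison_test'[of "\<lambda>i. real (card H) ^ 2 * (1 / real i ^ 2)" h])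
    show "summable (\<lambda>i. real (card H) ^ 2 * (1 / real i ^ 2))"
      using inverse_power_summable[of 2, where 'a = real] by (intro summable_mult) (simp add: field_simps)
    fix n assume "n \<ge> h"
    then show "norm (norm (singular_factor H n - 1)) \<le> real (card H) ^ 2 * (1 / real n ^ 2)"
      using singular_factor_bounds[OF assms, of n] by simp
  qed
  then have "convergent_prod (singular_factor H)"
    by (intro abs_convergent_prod_imp_convergent_prod) (simp add: abs_convergent_prod_conv_summable)
  then show ?thesis unfolding singular_series_eq by (rule convergent_prod_LIMSEQ)
qed

lemma prod_singular_factor:
  "(\<Prod>i\<le>P. singular_factor H i) * sieve_density P ^ card H = tuple_density P H"
proof -
  have "(\<Prod>i\<le>P. singular_factor H i)
      = (\<Prod>p\<in>primes_upto P. (1 - real (residue_count H p) / real p) / (1 - 1 / real p) ^ card H)"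
    unfolding singular_factor_def primes_upto_def by (rule prod.mono_neutral_cong_right) auto
  also have "\<dots> = tuple_density P H / sieve_density P ^ card H"
    by (simp add: prod_dividef tuple_density_def sieve_density_def prod_power_distrib)
  finally show ?thesis using sieve_density_pos[of P] by simp
qed

lemma singular_series_nonneg:
  assumes "H \<subseteq> {1..int h}"
  shows "singular_series H \<ge> 0"
  by (rule LIMSEQ_le_const[OF singular_series_LIMSEQ[OF assms]])
     (auto intro!: prod_nonneg singular_factor_nonneg)

text \<open>The part of the product up to \<open>P\<close> is \<open>tuple_density P H\<close> over
  \<open>sieve_density P ^ card H\<close>. With \<open>k = card H\<close>, the later factors lie
  between \<open>1 - k^2 / p^2\<close> and 1, and the sum of \<open>1 / p^2\<close> beyond
  \<open>P\<close> is at most \<open>1 / P\<close>.\<close>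

lemma singular_series_tuple_density:
  assumes H: "H \<subseteq> {1..int h}" and P: "h \<le> P" "P > 0"
  shows "singular_series H * sieve_density P ^ card H \<le> tuple_density P H"
    and "tuple_density P H * (1 - real (card H) ^ 2 / real P) \<le> singular_series H * sieve_density P ^ card H"
proof -
  let ?k = "card H" and ?V = "tuple_density P H"
  let ?F = "\<lambda>n. (\<Prod>i\<le>n. singular_factor H i) * sieve_density P ^ ?k"
  have lim: "?F \<longlonglongrightarrow> singular_series H * sieve_density P ^ ?k"
    by (intro tendsto_mult_right singular_series_LIMSEQ[OF H])
  have F: "?F n = ?V * (\<Prod>i\<in>{P<..n}. singular_factor H i)" if "n \<ge> P" for n
  proof -
    have "{..n} = {..P} \<union> {P<..n}" using that by auto
    then have "(\<Prod>i\<le>n. singular_factor H i) = (\<Prod>i\<le>P. singular_factor H i) * (\<Prod>i\<in>{P<..n}. singular_factor H i)"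
      by (simp add: prod.union_disjoint ivl_disj_int)
    then show ?thesis by (simp add: prod_singular_factor[symmetric])
  qed
  have "?F n \<le> ?V" if "n \<ge> P" for n
  proof -
    have "(\<Prod>i\<in>{P<..n}. singular_factor H i) \<le> 1"
      using P by (intro prod_le_1 conjI singular_factor_nonneg singular_factor_bounds[OF H]) auto
    then show ?thesis unfolding F[OF that] using tuple_density_nonneg[of P H]
      by (simp add: mult_left_le)
  qed
  then show "singular_series H * sieve_density P ^ ?k \<le> ?V"
    by (intro LIMSEQ_le_const2[OF lim]) auto
  have "?V * (1 - real ?k ^ 2 / real P) \<le> ?F n" if "n \<ge> P" for n
  proof -
    have k: "real ?k \<le> real P" using card_subset_interval_le[OF H] P by simp
    have "(\<Sum>i\<in>{P<..n}. real ?k ^ 2 / real i ^ 2) = real ?k ^ 2 * (\<Sum>i\<in>{P<..n}. 1 / real i ^ 2)"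
      by (simp add: sum_distrib_left)
    also have "\<dots> \<le> real ?k ^ 2 * (1 / real P)"
    proof (rule mult_left_mono)
      show "(\<Sum>i\<in>{P<..n}. 1 / real i ^ 2) \<le> 1 / real P"
        using sum_inverse_squares_tail_le[OF P(2) that]
        by (smt (verit) divide_nonneg_nonneg of_nat_0_le_iff)
    qed simp
    finally have "1 - real ?k ^ 2 / real P \<le> 1 - (\<Sum>i\<in>{P<..n}. real ?k ^ 2 / real i ^ 2)" by simp
    also have "\<dots> \<le> (\<Prod>i\<in>{P<..n}. 1 - real ?k ^ 2 / real i ^ 2)"
      using k by (intro prod_one_minus_ge) (auto simp: divide_le_eq_1 intro!: power_mono)
    also have "\<dots> \<le> (\<Prod>i\<in>{P<..n}. singular_factor H i)"
      using k P by (intro prod_mono) (auto simp: divide_le_eq_1 intro!: power_mono singular_factor_bounds[OF H])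
    finally show ?thesis unfolding F[OF that] using tuple_density_nonneg[of P H] by (intro mult_left_mono)
  qed
  then show "?V * (1 - real ?k ^ 2 / real P) \<le> singular_series H * sieve_density P ^ ?k"
    by (intro LIMSEQ_le_const[OF lim]) auto
qed

text \<open>The density drops little in one step, so a value caught between two consecutive
  densities is close to both.\<close>

lemma sieve_density_Suc_ge: "sieve_density P * (1 - 1 / real (Suc P)) \<le> sieve_density (Suc P)"
proof (cases "prime (Suc P)")
  case True
  then have "primes_upto (Suc P) = insert (Suc P) (primes_upto P)"
    by (auto simp: primes_upto_def le_Suc_eq)
  moreover have "Suc P \<notin> primes_upto P" by (auto simp: primes_upto_def)
  ultimately show ?thesis by (simp add: sieve_density_def mult.commute)
next
  case False
  then have "primes_upto (Suc P) = primes_upto P"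
    by (auto simp: primes_upto_def le_Suc_eq)
  then show ?thesis using sieve_density_pos[of P] by (simp add: sieve_density_def mult_left_le)
qed

text \<open>Exchanging \<open>sieve_density P\<close> for \<open>v\<close> costs a relative error of
  at most \<open>k / P\<close> with \<open>k = card H\<close>, because \<open>v\<close> lies between
  consecutive densities. Together with the error \<open>k^2 / P\<close> from the tail of the
  singular series this is at most \<open>2 k^2 / P\<close>.\<close>

lemma singular_series_scaled:
  assumes H: "H \<subseteq> {1..int h}" and P: "h \<le> P" "P > 0"
    and v: "v > 0" "v \<le> sieve_density P" "sieve_density (Suc P) < v"
  shows "singular_series H * v ^ card H \<le> tuple_density P H"
    and "\<bar>singular_series H * v ^ card H - tuple_density P H\<bar> \<le> 2 * real (card H) ^ 2 / real P"
proof -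
  let ?k = "card H" and ?V = "tuple_density P H" and ?\<sigma> = "sieve_density P"
  have S: "singular_series H \<ge> 0" by (rule singular_series_nonneg[OF H])
  have "singular_series H * v ^ ?k \<le> singular_series H * ?\<sigma> ^ ?k"
    using v S by (intro mult_left_mono power_mono) auto
  also have "\<dots> \<le> ?V" by (rule singular_series_tuple_density(1)[OF H P])
  finally show upper: "singular_series H * v ^ ?k \<le> ?V" .
  have k2: "real ?k \<le> real ?k ^ 2" by (cases "?k = 0") (auto simp: power2_eq_square)
  have V: "0 \<le> ?V" "?V \<le> 1" by (simp_all add: tuple_density_nonneg tuple_density_le_1)
  have w: "?V - singular_series H * ?\<sigma> ^ ?k \<le> real ?k ^ 2 / real P"
  proof -
    have "?V * (real ?k ^ 2 / real P) \<le> 1 * (real ?k ^ 2 / real P)"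
      using V by (intro mult_right_mono) auto
    then show ?thesis using singular_series_tuple_density(2)[OF H P] by (simp add: algebra_simps)
  qed
  have r: "?\<sigma> * (1 - 1 / real (Suc P)) \<le> v" using sieve_density_Suc_ge[of P] v by linarith
  have "singular_series H * ?\<sigma> ^ ?k * (1 - real ?k / real P) \<le> singular_series H * v ^ ?k"
  proof -
    have "1 - real ?k / real P \<le> 1 - real ?k / real (Suc P)"
      using P by (simp add: frac_le)
    also have "\<dots> \<le> (1 - 1 / real (Suc P)) ^ ?k"
      using Bernoulli_inequality[of "- (1 / real (Suc P))" ?k] by simp
    finally have "?\<sigma> ^ ?k * (1 - real ?k / real P) \<le> ?\<sigma> ^ ?k * (1 - 1 / real (Suc P)) ^ ?k"
      using sieve_density_pos[of P] by (intro mult_left_mono) auto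
    also have "\<dots> = (?\<sigma> * (1 - 1 / real (Suc P))) ^ ?k" by (rule power_mult_distrib[symmetric])
    also have "\<dots> \<le> v ^ ?k"
      using r sieve_density_pos[of P] by (intro power_mono) auto
    finally show ?thesis using S by (simp add: mult.assoc mult_left_mono)
  qed
  moreover have "singular_series H * ?\<sigma> ^ ?k * (real ?k / real P) \<le> 1 * (real ?k ^ 2 / real P)"
    using singular_series_tuple_density(1)[OF H P] V S sieve_density_pos[of P] k2
    by (intro mult_mono divide_right_mono) auto
  ultimately show "\<bar>singular_series H * v ^ ?k - ?V\<bar> \<le> 2 * real ?k ^ 2 / real P"
    using upper w by (simp add: algebra_simps)
qed

section \<open>Singular series summed over all \<open>k\<close>-subsets\<close>

lemma choose_le_power: "real (h choose k) \<le> real h ^ k"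
proof (cases "k \<le> h")
  case True
  then show ?thesis by (metis binomial_le_pow of_nat_le_iff of_nat_power)
qed (simp add: binomial_eq_0)

definition singular_sum :: "nat \<Rightarrow> nat \<Rightarrow> real" where
  "singular_sum h k = (\<Sum>H\<in>k_subsets h k. singular_series H)"

lemma singular_sum_nonneg: "singular_sum h k \<ge> 0"
  unfolding singular_sum_def by (intro sum_nonneg singular_series_nonneg) (auto dest: k_subsetsD)

lemma singular_sum_le:
  assumes P: "h \<le> P" "P > 0"
    and v: "v > 0" "v \<le> sieve_density P" "sieve_density (Suc P) < v"
  shows "singular_sum h k * v ^ k \<le> (\<Sum>H\<in>k_subsets h k. tuple_density P H)"
  unfolding singular_sum_def sum_distrib_right
  by (intro sum_mono) (use singular_series_scaled(1)[OF _ P v] in \<open>auto dest!: k_subsetsD\<close>)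

lemma singular_sum_le_choose:
  assumes P: "h \<le> P" "P > 0"
    and v: "v > 0" "v \<le> sieve_density P" "sieve_density (Suc P) < v"
  shows "singular_sum h k * v ^ k \<le> real (h choose k)"
proof -
  note singular_sum_le[OF P v]
  also have "(\<Sum>H\<in>k_subsets h k. tuple_density P H) \<le> (\<Sum>H\<in>k_subsets h k. 1)"
    by (intro sum_mono tuple_density_le_1)
  finally show ?thesis by (simp add: card_k_subsets)
qed

text \<open>Primes above \<open>h\<close> separate the elements of \<open>H\<close>, so their
  factors are \<open>1 - k / p <= (1 - 1 / p) ^ k\<close> by Bernoulli. The factors of the primes up
  to \<open>h\<close> are bounded by 1, which is why \<open>sieve_density h\<close> is divided
  out.\<close>

lemma sum_tuple_density_le:
  assumes P: "h \<le> P"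
  shows "(\<Sum>H\<in>k_subsets h k. tuple_density P H) \<le> real (h choose k) * (sieve_density P / sieve_density h) ^ k"
proof -
  have "tuple_density P H \<le> (sieve_density P / sieve_density h) ^ k" if "H \<in> k_subsets h k" for H
  proof -
    from that have H: "H \<subseteq> {1..int h}" "card H = k" by (auto dest: k_subsetsD)
    let ?g = "\<lambda>p. 1 - real (residue_count H p) / real p"
    let ?D = "primes_upto P - primes_upto h"
    have sub: "primes_upto h \<subseteq> primes_upto P" using P by (auto simp: primes_upto_def)
    have split: "prod g (primes_upto P) = prod g ?D * prod g (primes_upto h)" for g :: "nat \<Rightarrow> real"
      using sub by (intro prod.subset_diff) auto
    have "tuple_density P H = prod ?g ?D * tuple_density h H"
      unfolding tuple_density_def by (rule split)
    also have "\<dots> \<le> prod ?g ?D * 1"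
      by (intro mult_left_mono tuple_density_le_1 prod_nonneg ballI tuple_factor_bounds)
         (auto dest: primes_uptoD)
    also have "\<dots> \<le> (\<Prod>p\<in>?D. (1 - 1 / real p) ^ k)"
    proof (simp, intro prod_mono conjI)
      fix p assume "p \<in> ?D"
      then have p: "p \<ge> 2" "h \<le> p" by (auto simp: primes_upto_def prime_ge_2_nat)
      show "0 \<le> ?g p" using p by (intro tuple_factor_bounds) auto
      show "?g p \<le> (1 - 1 / real p) ^ k"
        using Bernoulli_inequality[of "- (1 / real p)" k] p
        by (simp add: residue_count_eq_card[OF H(1) p(2)] H(2))
    qed
    also have "\<dots> = (\<Prod>p\<in>?D. 1 - 1 / real p) ^ k" by (simp add: prod_power_distrib)
    also have "(\<Prod>p\<in>?D. 1 - 1 / real p) = sieve_density P / sieve_density h"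
      using sieve_density_pos[of h] split[of "\<lambda>p. 1 - 1 / real p"]
      by (simp add: sieve_density_def[symmetric])
    finally show ?thesis .
  qed
  then have "(\<Sum>H\<in>k_subsets h k. tuple_density P H) \<le> (\<Sum>H\<in>k_subsets h k. (sieve_density P / sieve_density h) ^ k)"
    by (intro sum_mono) auto
  then show ?thesis by (simp add: card_k_subsets)
qed

text \<open>Applied with \<open>v = 2 / ln y\<close>: writing \<open>(-2)\<^sup>k / (ln y)\<^sup>k = (-1)\<^sup>k v\<^sup>k\<close> turns the parity expansion at
  density \<open>1 / ln y\<close> into the inclusion-exclusion expansion, at twice that density, of the probability
  that nothing survives.\<close>

lemma alternating_singular_sum_bound:
  assumes h: "h > 0" and P: "h \<le> P"
    and v: "v > 0" "v \<le> sieve_density P" "sieve_density (Suc P) < v"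
  shows "\<bar>\<Sum>k<K. (- 1) ^ k * (singular_sum h k * v ^ k)\<bar>
    \<le> 1 / (real h * v) + (\<Sum>H\<in>k_subsets h K. tuple_density P H) + 2 * real K ^ 3 * real h ^ K / real P"
proof -
  let ?V = "\<lambda>k. \<Sum>H\<in>k_subsets h k. tuple_density P H"
  have P0: "P > 0" using h P by simp
  \<comment> \<open>A crude bound: at most \<open>h ^ K\<close> sets, each with error at most
    \<open>2 K^2 / P\<close>. It suffices because in the application \<open>P\<close> is at least of
    the order of a fixed power of \<open>x\<close>, while \<open>h ^ K\<close> grows more slowly
    than any such power.\<close>
  have approx: "\<bar>singular_sum h k * v ^ k - ?V k\<bar> \<le> 2 * real K ^ 2 * real h ^ K / real P" if "k < K" for k
  proof -
    have "\<bar>singular_sum h k * v ^ k - ?V k\<bar>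
        \<le> (\<Sum>H\<in>k_subsets h k. \<bar>singular_series H * v ^ k - tuple_density P H\<bar>)"
      unfolding singular_sum_def sum_distrib_right sum_subtractf[symmetric] by (rule sum_abs)
    also have "\<dots> \<le> (\<Sum>H\<in>k_subsets h k. 2 * real k ^ 2 / real P)"
      by (intro sum_mono) (use singular_series_scaled(2)[OF _ P P0 v] in \<open>auto dest!: k_subsetsD\<close>)
    also have "\<dots> = real (h choose k) * (2 * real k ^ 2 / real P)" by (simp add: card_k_subsets)
    also have "\<dots> \<le> real h ^ K * (2 * real K ^ 2 / real P)"
    proof (intro mult_mono divide_right_mono)
      have "real (h choose k) \<le> real h ^ k" by (rule choose_le_power)
      also have "\<dots> \<le> real h ^ K" using h that by (intro power_increasing) auto
      finally show "real (h choose k) \<le> real h ^ K" .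
    qed (use that in auto)
    finally show ?thesis by (simp add: mult_ac)
  qed
  have "\<bar>\<Sum>k<K. (- 1) ^ k * (singular_sum h k * v ^ k)\<bar>
      = \<bar>(\<Sum>k<K. (- 1) ^ k * ?V k) + (\<Sum>k<K. (- 1) ^ k * (singular_sum h k * v ^ k - ?V k))\<bar>"
    by (simp add: sum.distrib[symmetric] algebra_simps)
  also have "\<dots> \<le> \<bar>\<Sum>k<K. (- 1) ^ k * ?V k\<bar> + (\<Sum>k<K. \<bar>(- 1) ^ k * (singular_sum h k * v ^ k - ?V k)\<bar>)"
    by (intro order_trans[OF abs_triangle_ineq] add_left_mono sum_abs)
  also have "(\<Sum>k<K. \<bar>(- 1) ^ k * (singular_sum h k * v ^ k - ?V k)\<bar>) \<le> (\<Sum>k<K. 2 * real K ^ 2 * real h ^ K / real P)"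
    using approx by (intro sum_mono) (auto simp: abs_mult power_abs)
  also have "\<bar>\<Sum>k<K. (- 1) ^ k * ?V k\<bar> \<le> 1 / (real h * sieve_density P) + ?V K"
    by (rule alternating_tuple_density_bound[OF h])
  also have "1 / (real h * sieve_density P) \<le> 1 / (real h * v)"
    using h v by (intro divide_left_mono mult_left_mono mult_pos_pos sieve_density_pos) auto
  finally show ?thesis by (simp add: power3_eq_cube power2_eq_square mult_ac)
qed

section \<open>Mertens' theorems from the case of a single prime\<close>

lemma summable_telescope_bound:
  fixes f g :: "nat \<Rightarrow> real"
  assumes "g \<longlonglongrightarrow> c" "eventually (\<lambda>n. \<bar>f n\<bar> \<le> C * (g n - g (Suc n))) sequentially"
  shows "summable f"
proof (rule summable_comparison_test_ev)
  show "summable (\<lambda>n. C * (g n - g (Suc n)))"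
    using telescope_summable'[OF assms(1)] by (rule summable_mult)
qed (use assms(2) in simp)

section \<open>The prime number theorem with error term\<close>

lemma prime_pi_nat: "prime_pi (real n) = card (primes_upto n)"
  by (simp add: prime_pi_def primes_upto_def)

text \<open>Two explicit antiderivatives bracket the integral: the derivative of \<open>F1\<close>
  is at most \<open>1 / ln y\<close>, and that of \<open>F2\<close> is at least
  \<open>1 / ln y\<close> as soon as \<open>ln y >= 4\<close>, whence
  \<open>a = exp 4\<close>.\<close>

lemma log_integral_asymp:
  "eventually (\<lambda>x::real. \<bar>integral {2..x} (\<lambda>y. 1 / ln y) - x / ln x\<bar> \<le> 3 * x / (ln x)\<^sup>2) at_top"
proof -
  define a :: real where "a = exp 4"
  define F1 :: "real \<Rightarrow> real" where "F1 = (\<lambda>y. y / ln y)"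
  define F2 :: "real \<Rightarrow> real" where "F2 = (\<lambda>y. y / ln y + 2 * y / (ln y)\<^sup>2)"
  have a5: "a \<ge> 5" using exp_ge_add_one_self[of 4] by (simp add: a_def)
  have int: "(\<lambda>y::real. 1 / ln y) integrable_on {u..v}" if "u \<ge> 2" for u v
    using that by (intro integrable_continuous_interval continuous_intros) auto
  \<comment> \<open>\<open>B\<close> absorbs the integral over \<open>{2..a}\<close> and the
    boundary values at \<open>a\<close>.\<close>
  define B where "B = \<bar>integral {2..a} (\<lambda>y. 1 / ln y)\<bar> + \<bar>F1 a\<bar> + \<bar>F2 a\<bar>"
  have main: "\<bar>integral {2..x} (\<lambda>y. 1 / ln y) - x / ln x\<bar> \<le> B + 2 * x / (ln x)\<^sup>2" if x: "x \<ge> a" for x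
  proof -
    have lny: "ln y \<ge> 4" if "y \<ge> a" for y
      using that a5 by (subst ln_ge_iff) (auto simp: a_def)
    have split: "integral {2..x} (\<lambda>y. 1 / ln y) = integral {2..a} (\<lambda>y. 1 / ln y) + integral {a..x} (\<lambda>y. 1 / ln y)"
      using a5 x int[of 2 x] by (intro Henstock_Kurzweil_Integration.integral_combine[symmetric]) auto
    have 1: "((\<lambda>y. 1 / ln y - 1 / (ln y)\<^sup>2) has_integral (F1 x - F1 a)) {a..x}"
    proof (rule fundamental_theorem_of_calculus[OF x])
      fix y assume "y \<in> {a..x}"
      then have y: "y > 0" "ln y > 0" using a5 lny[of y] by auto
      have "(F1 has_real_derivative (1 / ln y - 1 / (ln y)\<^sup>2)) (at y)"
        unfolding F1_def using y by (auto intro!: derivative_eq_intros simp: diff_divide_distrib power2_eq_square)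
      then show "(F1 has_vector_derivative (1 / ln y - 1 / (ln y)\<^sup>2)) (at y within {a..x})"
        by (simp add: has_real_derivative_iff_has_vector_derivative has_vector_derivative_at_within)
    qed
    have 2: "((\<lambda>y. 1 / ln y + 1 / (ln y)\<^sup>2 - 4 / (ln y) ^ 3) has_integral (F2 x - F2 a)) {a..x}"
    proof (rule fundamental_theorem_of_calculus[OF x])
      fix y assume "y \<in> {a..x}"
      then have y: "y > 0" "ln y > 0" using a5 lny[of y] by auto
      have "(F2 has_real_derivative (1 / ln y + 1 / (ln y)\<^sup>2 - 4 / (ln y) ^ 3)) (at y)"
        unfolding F2_def using y
        by (auto intro!: derivative_eq_intros simp: diff_divide_distrib power2_eq_square)
           (simp add: field_simps power2_eq_square power3_eq_cube power4_eq_xxxx)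
      then show "(F2 has_vector_derivative (1 / ln y + 1 / (ln y)\<^sup>2 - 4 / (ln y) ^ 3)) (at y within {a..x})"
        by (simp add: has_real_derivative_iff_has_vector_derivative has_vector_derivative_at_within)
    qed
    have I: "((\<lambda>y. 1 / ln y) has_integral integral {a..x} (\<lambda>y. 1 / ln y)) {a..x}"
      using int[of a x] a5 by (intro integrable_integral) auto
    have "F1 x - F1 a \<le> integral {a..x} (\<lambda>y. 1 / ln y)"
      by (rule has_integral_le[OF 1 I]) auto
    moreover have "integral {a..x} (\<lambda>y. 1 / ln y) \<le> F2 x - F2 a"
    proof (rule has_integral_le[OF I 2])
      fix y assume "y \<in> {a..x}"
      then have "ln y \<ge> 4" using lny by auto
      then have "4 / (ln y) ^ 3 \<le> 1 / (ln y)\<^sup>2"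
        by (simp add: field_simps power2_eq_square power3_eq_cube)
      then show "1 / ln y \<le> 1 / ln y + 1 / (ln y)\<^sup>2 - 4 / (ln y) ^ 3" by simp
    qed
    moreover have "2 * x / (ln x)\<^sup>2 \<ge> 0" using x a5 by simp
    moreover have "F1 x = x / ln x" "F2 x = x / ln x + 2 * x / (ln x)\<^sup>2" by (simp_all add: F1_def F2_def)
    ultimately show ?thesis unfolding split B_def by linarith
  qed
  have "eventually (\<lambda>x::real. B \<le> x / (ln x)\<^sup>2) at_top" by real_asymp
  moreover have "eventually (\<lambda>x. x \<ge> a) at_top" by (rule eventually_ge_at_top)
  ultimately show ?thesis
  proof eventually_elim
    case (elim x)
    have "B + 2 * x / (ln x)\<^sup>2 \<le> 3 * x / (ln x)\<^sup>2" proof -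
      have "3 * x / (ln x)\<^sup>2 = x / (ln x)\<^sup>2 + 2 * x / (ln x)\<^sup>2"
        by (simp add: add_divide_distrib[symmetric])
      with elim(1) show ?thesis by linarith
    qed
    then show ?case using main[OF elim(2)] by linarith
  qed
qed

lemma singular_series_singleton: "singular_series {a} = 1"
proof -
  have "singular_factor {a} = (\<lambda>_. 1)"
    by (rule ext) (auto simp: singular_factor_def residue_count_def prime_nat_iff)
  then show ?thesis by (simp add: singular_series_eq)
qed

lemma sum_prime_indicator: "(\<Sum>n\<in>{1..int N}. indicat_real {p. prime p} n) = real (card (primes_upto N))"
proof -
  have "(\<Sum>n\<in>{1..int N}. indicat_real {p. prime p} n) = real (card {n \<in> {1..int N}. prime n})"
    by (simp add: indicator_def sum.If_cases Int_def)
  also have "{n \<in> {1..int N}. prime n} = int ` primes_upto N"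
  proof (intro equalityI subsetI)
    fix n assume n: "n \<in> {n \<in> {1..int N}. prime n}"
    then have "n = int (nat n)" "prime (nat n)" "nat n \<le> N" by auto
    then show "n \<in> int ` primes_upto N" unfolding primes_upto_def by blast
  next
    fix n assume "n \<in> int ` primes_upto N"
    then show "n \<in> {n \<in> {1..int N}. prime n}" by (auto simp: primes_upto_def dest: prime_ge_1_nat)
  qed
  finally show ?thesis by (simp add: card_image)
qed

text \<open>The conjecture for \<open>H = {0}\<close>, whose singular series is 1. Its power saving
  is far smaller than the error made in replacing the logarithmic integral by
  \<open>x / ln x\<close>.\<close>

lemma prime_number_theorem_error:
  assumes "quantitative_Hardy_Littlewood"
  shows "eventually (\<lambda>n. \<bar>real (card (primes_upto n)) - real n / ln (real n)\<bar> \<le> 4 * real n / (ln (real n))\<^sup>2) sequentially"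
proof -
  from assms obtain \<epsilon> C where \<epsilon>: "\<epsilon> > 0" "C > 0" and HL:
    "\<And>x k (H::int set). x \<ge> 10 \<Longrightarrow> real k \<le> (ln (ln x)) ^ 5 \<Longrightarrow> finite H \<Longrightarrow> card H = k \<Longrightarrow>
       (\<forall>h\<in>H. 0 \<le> h \<and> real_of_int h \<le> (ln x)\<^sup>2) \<Longrightarrow>
        \<bar>(\<Sum>n\<in>{1..\<lfloor>x\<rfloor>}. \<Prod>h\<in>H. indicat_real {p::int. prime p} (n + h))
           - singular_series H * integral {2..x} (\<lambda>y. 1 / (ln y) ^ k)\<bar>
        \<le> C * x powr (1 - \<epsilon>)"
    unfolding quantitative_Hardy_Littlewood_def by blast
  have "eventually (\<lambda>x::real. x \<ge> 10) at_top" by (rule eventually_ge_at_top)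
  moreover have "eventually (\<lambda>x::real. 1 \<le> (ln (ln x)) ^ 5) at_top" by real_asymp
  moreover have "eventually (\<lambda>x::real. C * x powr (1 - \<epsilon>) \<le> x / (ln x)\<^sup>2) at_top"
    using \<epsilon> by real_asymp
  moreover note log_integral_asymp
  ultimately have "eventually (\<lambda>x. \<bar>(\<Sum>n\<in>{1..\<lfloor>x\<rfloor>}. indicat_real {p::int. prime p} n) - x / ln x\<bar> \<le> 4 * x / (ln x)\<^sup>2) at_top"
  proof eventually_elim
    case (elim x)
    have "\<bar>(\<Sum>n\<in>{1..\<lfloor>x\<rfloor>}. indicat_real {p::int. prime p} n) - integral {2..x} (\<lambda>y. 1 / ln y)\<bar> \<le> C * x powr (1 - \<epsilon>)"
      using HL[of x 1 "{0}"] elim by (simp add: singular_series_singleton)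
    then have "\<bar>(\<Sum>n\<in>{1..\<lfloor>x\<rfloor>}. indicat_real {p::int. prime p} n) - x / ln x\<bar> \<le> x / (ln x)\<^sup>2 + 3 * x / (ln x)\<^sup>2"
      using elim by linarith
    then show ?case by (simp add: field_simps)
  qed
  then have "eventually (\<lambda>n. \<bar>(\<Sum>k\<in>{1..\<lfloor>real n\<rfloor>}. indicat_real {p::int. prime p} k) - real n / ln (real n)\<bar>
      \<le> 4 * real n / (ln (real n))\<^sup>2) sequentially"
    using eventually_compose_filterlim[OF _ filterlim_real_sequentially] by blast
  then show ?thesis by (simp add: sum_prime_indicator)
qed

section \<open>Mertens' sum and product over primes\<close>

lemma summable_inverse_n_ln_squared: "summable (\<lambda>n. 1 / (real n * (ln (real n))\<^sup>2))"
proof (rule summable_telescope_bound)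
  show "(\<lambda>n. 1 / ln (real n)) \<longlonglongrightarrow> 0" by real_asymp
  have "eventually (\<lambda>n. 1 / (real n * (ln (real n))\<^sup>2) \<le> 2 * (1 / ln (real n) - 1 / ln (real n + 1))) sequentially"
    by real_asymp
  with eventually_gt_at_top[of 1]
  show "eventually (\<lambda>n. \<bar>1 / (real n * (ln (real n))\<^sup>2)\<bar> \<le> 2 * (1 / ln (real n) - 1 / ln (real (Suc n)))) sequentially"
    by eventually_elim (simp add: add.commute)
qed

lemma primes_upto_Suc:
  "primes_upto (Suc z) = (if prime (Suc z) then insert (Suc z) (primes_upto z) else primes_upto z)"
  by (auto simp: primes_upto_def le_Suc_eq)

lemma Suc_notin_primes_upto [simp]: "Suc z \<notin> primes_upto z"
  by (auto simp: primes_upto_def)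

lemma primes_upto_0 [simp]: "primes_upto 0 = {}" "primes_upto (Suc 0) = {}"
  by (auto simp: primes_upto_def le_Suc_eq dest: prime_gt_1_nat)

lemma card_primes_upto_le: "card (primes_upto z) \<le> z"
proof -
  have "primes_upto z \<subseteq> {1..z}" by (auto simp: primes_upto_def dest: prime_ge_1_nat)
  then have "card (primes_upto z) \<le> card {1..z}" by (intro card_mono) auto
  then show ?thesis by simp
qed

text \<open>Abel summation; the term for \<open>m = 0\<close> is 0, its denominator being 0.\<close>

lemma sum_inverse_primes_eq:
  assumes "z \<ge> 1"
  shows "(\<Sum>p\<in>primes_upto z. 1 / real p)
    = real (card (primes_upto z)) / real z + (\<Sum>m<z. real (card (primes_upto m)) / (real m * real (Suc m)))"
  using assms
proof (induction z rule: dec_induct)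
  case (step z)
  have *: "c / real z = c / real (Suc z) + c / (real z * real (Suc z))" for c :: real
  proof -
    have "1 / real z = 1 / real (Suc z) + 1 / (real z * real (Suc z))"
      using step by (simp add: divide_simps)
    then have "c * (1 / real z) = c * (1 / real (Suc z) + 1 / (real z * real (Suc z)))" by simp
    then show ?thesis by (simp add: distrib_left)
  qed
  show ?case using step *[of "real (card (primes_upto z))"]
    by (auto simp: primes_upto_Suc add_divide_distrib)
qed simp

lemma prime_count_ratio_error:
  assumes "quantitative_Hardy_Littlewood"
  shows "eventually (\<lambda>m. \<bar>real (card (primes_upto m)) / (real m * real (Suc m)) - 1 / ((real m + 1) * ln (real m))\<bar>
    \<le> 4 * (1 / (real m * (ln (real m))\<^sup>2))) sequentially"
  using prime_number_theorem_error[OF assms] eventually_gt_at_top[of 1]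
proof eventually_elim
  case (elim m)
  then have m: "real m > 0" "ln (real m) > 0" by auto
  have "\<bar>real (card (primes_upto m)) / (real m * real (Suc m)) - 1 / ((real m + 1) * ln (real m))\<bar>
      = \<bar>real (card (primes_upto m)) - real m / ln (real m)\<bar> / (real m * (real m + 1))"
  proof -
    have "real (card (primes_upto m)) / (real m * real (Suc m)) - 1 / ((real m + 1) * ln (real m))
        = (real (card (primes_upto m)) - real m / ln (real m)) / (real m * (real m + 1))"
      using m by (simp add: divide_simps) (simp add: algebra_simps)
    then show ?thesis using m by simp
  qed
  also have "\<dots> \<le> (4 * real m / (ln (real m))\<^sup>2) / (real m * real m)"
    using elim m by (intro frac_le mult_left_mono) auto
  also have "\<dots> = 4 * (1 / (real m * (ln (real m))\<^sup>2))" using m by (simp add: field_simps)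
  finally show ?case .
qed

text \<open>Partial summation leaves the sum of the \<open>\<rho> m\<close>. Both
  \<open>\<rho> m\<close> and the increments of \<open>ln (ln m)\<close> are
  \<open>1 / (m * ln m)\<close> up to \<open>O(1 / (m * (ln m)^2))\<close>, so their differences are
  summable.\<close>

lemma mertens_second:
  assumes "quantitative_Hardy_Littlewood"
  obtains B where "\<And>z. z \<ge> 1 \<Longrightarrow> \<bar>(\<Sum>p\<in>primes_upto z. 1 / real p) - ln (ln (real z))\<bar> \<le> B"
proof -
  define \<rho> where "\<rho> = (\<lambda>m. real (card (primes_upto m)) / (real m * real (Suc m)))"
  define d where "d = (\<lambda>m. \<rho> m - (ln (ln (real (Suc m))) - ln (ln (real m))))"
  have "summable d"
  proof (rule summable_comparison_test_ev)
    show "summable (\<lambda>n. 5 * (1 / (real n * (ln (real n))\<^sup>2)))"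
      by (intro summable_mult summable_inverse_n_ln_squared)
    have "eventually (\<lambda>m. \<bar>1 / ((real m + 1) * ln (real m)) - (ln (ln (real m + 1)) - ln (ln (real m)))\<bar>
        \<le> 1 / (real m * (ln (real m))\<^sup>2)) sequentially"
      by real_asymp
    with prime_count_ratio_error[OF assms]
    show "eventually (\<lambda>n. norm (d n) \<le> 5 * (1 / (real n * (ln (real n))\<^sup>2))) sequentially"
    proof eventually_elim
      case (elim m)
      then show ?case by (simp add: d_def \<rho>_def add.commute)
    qed
  qed
  then have "Bseq (\<lambda>z. \<Sum>m<z. d m)"
    using summable_iff_convergent convergent_imp_Bseq by blast
  then obtain B where B: "\<And>z. \<bar>\<Sum>m<z. d m\<bar> \<le> B" by (auto simp: Bseq_def)
  have "\<bar>(\<Sum>p\<in>primes_upto z. 1 / real p) - ln (ln (real z))\<bar> \<le> B + 1" if z: "z \<ge> 1" for z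
  proof -
    have "(\<Sum>m<z. d m) = (\<Sum>m<z. \<rho> m) - (\<Sum>m<z. ln (ln (real (Suc m))) - ln (ln (real m)))"
      by (simp add: d_def sum_subtractf)
    \<comment> \<open>The lower boundary term \<open>ln (ln 0)\<close> of the telescoping sum
      evaluates to 0, so no constant remains.\<close>
    also have "(\<Sum>m<z. ln (ln (real (Suc m))) - ln (ln (real m))) = ln (ln (real z))"
      by (subst sum_lessThan_telescope) simp
    finally have "(\<Sum>p\<in>primes_upto z. 1 / real p) - ln (ln (real z))
        = real (card (primes_upto z)) / real z + (\<Sum>m<z. d m)"
      using sum_inverse_primes_eq[OF z] by (simp add: \<rho>_def)
    moreover have "0 \<le> real (card (primes_upto z)) / real z" "real (card (primes_upto z)) / real z \<le> 1"
      using card_primes_upto_le[of z] z by (auto simp: field_simps)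
    ultimately show ?thesis using B[of z] by linarith
  qed
  then show ?thesis by (rule that)
qed

text \<open>Exponentiates the previous estimate by means of
  \<open>-u - 2 u^2 <= ln (1 - u) <= -u\<close> for \<open>u = 1 / p <= 1/2\<close>. The quadratic
  terms are bounded by the convergent sum \<open>D\<close>.\<close>

lemma mertens_third:
  assumes "quantitative_Hardy_Littlewood"
  obtains c C where "c > 0" "C > 0"
    "\<And>z. z \<ge> 2 \<Longrightarrow> c / ln (real z) \<le> sieve_density z \<and> sieve_density z \<le> C / ln (real z)"
proof -
  from mertens_second[OF assms] obtain B
    where B: "\<And>z. z \<ge> 1 \<Longrightarrow> \<bar>(\<Sum>p\<in>primes_upto z. 1 / real p) - ln (ln (real z))\<bar> \<le> B" by blast
  have summ: "summable (\<lambda>n. 1 / real n ^ 2)"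
    using inverse_power_summable[of 2, where 'a = real] by (simp add: field_simps)
  define D where "D = (\<Sum>n. 1 / real n ^ 2)"
  have main: "exp (- B - 2 * D) / ln (real z) \<le> sieve_density z \<and> sieve_density z \<le> exp B / ln (real z)"
    if z: "z \<ge> 2" for z
  proof -
    have lz: "ln (real z) > 0" using z by simp
    let ?S = "\<Sum>p\<in>primes_upto z. 1 / real p"
    have lnp: "ln (1 - 1 / real p) \<le> - (1 / real p) \<and> - (1 / real p) - 2 * (1 / real p ^ 2) \<le> ln (1 - 1 / real p)"
      if "p \<in> primes_upto z" for p
    proof -
      have p: "p \<ge> 2" using that by (auto dest: primes_uptoD)
      then have "1 / real p \<le> 1 / 2" by (simp add: field_simps)
      moreover have "ln (1 - 1 / real p) \<le> (1 - 1 / real p) - 1" using p by (intro ln_le_minus_one) auto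
      ultimately show ?thesis using ln_one_minus_pos_lower_bound[of "1 / real p"] p
        by (simp add: power_divide)
    qed
    have "sieve_density z = exp (\<Sum>p\<in>primes_upto z. ln (1 - 1 / real p))"
      unfolding sieve_density_def by (subst exp_sum) (auto intro!: prod.cong dest: primes_uptoD)
    moreover have "(\<Sum>p\<in>primes_upto z. ln (1 - 1 / real p)) \<le> - ?S"
      unfolding sum_negf[symmetric] by (intro sum_mono) (use lnp in auto)
    moreover have "- ?S - 2 * D \<le> (\<Sum>p\<in>primes_upto z. ln (1 - 1 / real p))"
    proof -
      have "(\<Sum>p\<in>primes_upto z. 1 / real p ^ 2) \<le> D"
        unfolding D_def by (intro sum_le_suminf summ) auto
      then have "- ?S - 2 * D \<le> - ?S - 2 * (\<Sum>p\<in>primes_upto z. 1 / real p ^ 2)" by simp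
      also have "\<dots> = (\<Sum>p\<in>primes_upto z. - (1 / real p) - 2 * (1 / real p ^ 2))"
        by (simp add: sum_subtractf sum_negf sum_distrib_left)
      also have "\<dots> \<le> (\<Sum>p\<in>primes_upto z. ln (1 - 1 / real p))" by (intro sum_mono) (use lnp in auto)
      finally show ?thesis .
    qed
    moreover have "exp (- B - 2 * D) / ln (real z) = exp (- B - 2 * D - ln (ln (real z)))"
      "exp B / ln (real z) = exp (B - ln (ln (real z)))"
      using lz by (simp_all add: exp_diff)
    moreover have "\<bar>?S - ln (ln (real z))\<bar> \<le> B" using B[of z] z by simp
    ultimately show ?thesis by (simp only: exp_le_cancel_iff) linarith
  qed
  show ?thesis by (rule that[OF _ _ main]) auto
qed

section \<open>Correlations of the parity of the prime counting function\<close>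

text \<open>Offsets instead of the primes themselves, so that the \<open>k\<close>-subsets of every
  window, whatever \<open>n\<close>, belong to the same family of tuples \<open>H\<close>.\<close>

definition prime_window :: "nat \<Rightarrow> int \<Rightarrow> int set" where
  "prime_window h n = {m \<in> {1..int h}. prime (n + m)}"

lemma finite_prime_window [simp]: "finite (prime_window h n)"
  by (rule finite_subset[of _ "{1..int h}"]) (auto simp: prime_window_def)

lemma choose_prime_window:
  "real (card (prime_window h n) choose k)
    = (\<Sum>H\<in>k_subsets h k. \<Prod>m\<in>H. indicat_real {p. prime p} (n + m))"
proof -
  have "{H. H \<subseteq> prime_window h n \<and> card H = k} = {H \<in> k_subsets h k. H \<subseteq> prime_window h n}"
    by (auto simp: k_subsets_def prime_window_def)
  then have "real (card (prime_window h n) choose k) = real (card {H \<in> k_subsets h k. H \<subseteq> prime_window h n})"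
    using n_subsets[OF finite_prime_window, of h n k] by metis
  also have "\<dots> = (\<Sum>H\<in>k_subsets h k. if H \<subseteq> prime_window h n then 1 else 0)"
    by (simp add: sum.If_cases Int_def)
  also have "\<dots> = (\<Sum>H\<in>k_subsets h k. \<Prod>m\<in>H. indicat_real {p. prime p} (n + m))"
  proof (rule sum.cong[OF refl])
    fix H assume "H \<in> k_subsets h k"
    then have H: "finite H" "H \<subseteq> {1..int h}" by (auto dest: k_subsetsD)
    show "(if H \<subseteq> prime_window h n then 1 else 0) = (\<Prod>m\<in>H. indicat_real {p. prime p} (n + m))"
    proof (cases "H \<subseteq> prime_window h n")
      case True
      then have "(\<Prod>m\<in>H. indicat_real {p. prime p} (n + m)) = (\<Prod>m\<in>H. 1)"
        by (intro prod.cong) (auto simp: prime_window_def)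
      with True show ?thesis by simp
    next
      case False
      then obtain m where "m \<in> H" "\<not> prime (n + m)" using H by (auto simp: prime_window_def)
      then have "(\<Prod>m\<in>H. indicat_real {p. prime p} (n + m)) = 0"
        using H by (intro prod_zero bexI[of _ m]) auto
      with False show ?thesis by simp
    qed
  qed
  finally show ?thesis .
qed

text \<open>The conjecture frozen at one \<open>x\<close>, with \<open>K\<close> in place of the
  bound on the size of tuples. This keeps the estimates explicit until the parameters are
  chosen.\<close>

definition tuple_estimate :: "real \<Rightarrow> real \<Rightarrow> real \<Rightarrow> nat \<Rightarrow> bool" where
  "tuple_estimate \<epsilon> C x K \<longleftrightarrow> (\<forall>H::int set. finite H \<longrightarrow> card H \<le> K \<longrightarrow>
     (\<forall>h\<in>H. 0 \<le> h \<and> real_of_int h \<le> (ln x)\<^sup>2) \<longrightarrow>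
        \<bar>(\<Sum>n\<in>{1..\<lfloor>x\<rfloor>}. \<Prod>h\<in>H. indicat_real {p::int. prime p} (n + h))
           - singular_series H * integral {2..x} (\<lambda>y. 1 / (ln y) ^ card H)\<bar>
        \<le> C * x powr (1 - \<epsilon>))"

lemma tuple_estimate_sum:
  assumes est: "tuple_estimate \<epsilon> C x K" and k: "k \<le> K" and h: "real h \<le> (ln x)\<^sup>2"
  shows "\<bar>(\<Sum>n\<in>{1..\<lfloor>x\<rfloor>}. real (card (prime_window h n) choose k))
      - singular_sum h k * integral {2..x} (\<lambda>y. 1 / (ln y) ^ k)\<bar>
    \<le> real (h choose k) * (C * x powr (1 - \<epsilon>))"
proof -
  let ?I = "integral {2..x} (\<lambda>y. 1 / (ln y) ^ k)"
  let ?T = "\<lambda>H. \<Sum>n\<in>{1..\<lfloor>x\<rfloor>}. \<Prod>m\<in>H. indicat_real {p::int. prime p} (n + m)"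
  have "(\<Sum>n\<in>{1..\<lfloor>x\<rfloor>}. real (card (prime_window h n) choose k)) = (\<Sum>H\<in>k_subsets h k. ?T H)"
    unfolding choose_prime_window by (rule sum.swap)
  then have "\<bar>(\<Sum>n\<in>{1..\<lfloor>x\<rfloor>}. real (card (prime_window h n) choose k)) - singular_sum h k * ?I\<bar>
      = \<bar>\<Sum>H\<in>k_subsets h k. ?T H - singular_series H * ?I\<bar>"
    by (simp add: singular_sum_def sum_distrib_right sum_subtractf)
  also have "\<dots> \<le> (\<Sum>H\<in>k_subsets h k. \<bar>?T H - singular_series H * ?I\<bar>)" by (rule sum_abs)
  also have "\<dots> \<le> (\<Sum>H\<in>k_subsets h k. C * x powr (1 - \<epsilon>))"
  proof (rule sum_mono)
    fix H assume "H \<in> k_subsets h k"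
    then have H: "finite H" "card H = k" "H \<subseteq> {1..int h}" by (auto dest: k_subsetsD)
    have "0 \<le> m \<and> real_of_int m \<le> (ln x)\<^sup>2" if "m \<in> H" for m
    proof -
      have "1 \<le> m" "m \<le> int h" using that H(3) by auto
      then show ?thesis using h by linarith
    qed
    then show "\<bar>?T H - singular_series H * ?I\<bar> \<le> C * x powr (1 - \<epsilon>)"
      using est H k unfolding tuple_estimate_def by blast
  qed
  also have "\<dots> = real (h choose k) * (C * x powr (1 - \<epsilon>))" by (simp add: card_k_subsets)
  finally show ?thesis .
qed

text \<open>Truncates \<open>(1 - 2) ^ N\<close> at order \<open>K\<close>, where \<open>N\<close>
  is the number of primes in the window, and applies the tuple estimate to each binomial moment. The
  truncation error \<open>2 ^ K * (N choose K)\<close> is itself such a moment, so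
  \<open>K + 1\<close> error terms arise in all.\<close>

lemma parity_correlation_expansion:
  assumes est: "tuple_estimate \<epsilon> C x K" and C: "C > 0" and h: "h \<ge> 1" "real h \<le> (ln x)\<^sup>2"
  shows "\<bar>\<Sum>n\<in>{1..\<lfloor>x\<rfloor>}. (- 1) ^ card (prime_window h n)\<bar>
    \<le> \<bar>\<Sum>k<K. (- 2) ^ k * (singular_sum h k * integral {2..x} (\<lambda>y. 1 / (ln y) ^ k))\<bar>
      + 2 ^ K * (singular_sum h K * integral {2..x} (\<lambda>y. 1 / (ln y) ^ K))
      + (real K + 1) * (2 * real h) ^ K * (C * x powr (1 - \<epsilon>))"
proof -
  let ?N = "\<lambda>n. card (prime_window h n)" and ?A = "{1..\<lfloor>x\<rfloor>}"
  define T where "T = (\<lambda>k. \<Sum>n\<in>?A. real (?N n choose k))"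
  define G where "G = (\<lambda>k. singular_sum h k * integral {2..x} (\<lambda>y. 1 / (ln y) ^ k))"
  define E where "E = C * x powr (1 - \<epsilon>)"
  have E: "E \<ge> 0" using C by (simp add: E_def)
  have "\<bar>(\<Sum>n\<in>?A. (- 1) ^ ?N n) - (\<Sum>k<K. (- 2) ^ k * T k)\<bar>
      = \<bar>\<Sum>n\<in>?A. (1 - 2) ^ ?N n - (\<Sum>k<K. (- 2) ^ k * real (?N n choose k))\<bar>"
  proof -
    have "(\<Sum>k<K. (- 2) ^ k * T k) = (\<Sum>n\<in>?A. \<Sum>k<K. (- 2) ^ k * real (?N n choose k))"
      unfolding T_def sum_distrib_left by (rule sum.swap)
    then show ?thesis by (simp add: sum_subtractf)
  qed
  also have "\<dots> \<le> (\<Sum>n\<in>?A. \<bar>(1 - 2) ^ ?N n - (\<Sum>k<K. (- 2) ^ k * real (?N n choose k))\<bar>)"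
    by (rule sum_abs)
  also have "\<dots> \<le> (\<Sum>n\<in>?A. 2 ^ K * real (?N n choose K))"
    by (intro sum_mono truncated_binomial_bound) auto
  also have "\<dots> = 2 ^ K * T K" by (simp add: T_def sum_distrib_left)
  finally have 1: "\<bar>(\<Sum>n\<in>?A. (- 1) ^ ?N n) - (\<Sum>k<K. (- 2) ^ k * T k)\<bar> \<le> 2 ^ K * T K" .
  have err: "2 ^ k * \<bar>T k - G k\<bar> \<le> (2 * real h) ^ K * E" if "k \<le> K" for k
  proof -
    have "2 ^ k * \<bar>T k - G k\<bar> \<le> 2 ^ k * (real (h choose k) * E)"
      using tuple_estimate_sum[OF est that h(2)] by (intro mult_left_mono) (auto simp: T_def G_def E_def)
    also have "\<dots> \<le> 2 ^ k * (real h ^ k * E)"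
      using E by (intro mult_left_mono mult_right_mono choose_le_power) auto
    also have "\<dots> = (2 * real h) ^ k * E" by (simp add: power_mult_distrib)
    also have "\<dots> \<le> (2 * real h) ^ K * E"
      using E h that by (intro mult_right_mono power_increasing) auto
    finally show ?thesis .
  qed
  have "\<bar>(\<Sum>k<K. (- 2) ^ k * T k) - (\<Sum>k<K. (- 2) ^ k * G k)\<bar> = \<bar>\<Sum>k<K. (- 2) ^ k * (T k - G k)\<bar>"
    by (simp add: sum_subtractf algebra_simps)
  also have "\<dots> \<le> (\<Sum>k<K. \<bar>(- 2) ^ k * (T k - G k)\<bar>)" by (rule sum_abs)
  also have "\<dots> \<le> (\<Sum>k<K. (2 * real h) ^ K * E)"
    using err by (intro sum_mono) (auto simp: abs_mult power_abs)
  also have "\<dots> = real K * ((2 * real h) ^ K * E)" by simp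
  finally have 2: "\<bar>(\<Sum>k<K. (- 2) ^ k * T k) - (\<Sum>k<K. (- 2) ^ k * G k)\<bar> \<le> real K * ((2 * real h) ^ K * E)" .
  have "2 ^ K * (T K - G K) \<le> 2 ^ K * \<bar>T K - G K\<bar>" by (intro mult_left_mono) auto
  also have "\<dots> \<le> (2 * real h) ^ K * E" by (rule err) simp
  finally have 3: "2 ^ K * T K \<le> 2 ^ K * G K + (2 * real h) ^ K * E"
    by (simp add: right_diff_distrib)
  have "(real K + 1) * (2 * real h) ^ K * E = real K * ((2 * real h) ^ K * E) + (2 * real h) ^ K * E"
    by (simp add: algebra_simps)
  then have "\<bar>\<Sum>n\<in>?A. (- 1) ^ ?N n\<bar> \<le> \<bar>\<Sum>k<K. (- 2) ^ k * G k\<bar> + 2 ^ K * G K + (real K + 1) * (2 * real h) ^ K * E"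
    using 1 2 3 by linarith
  then show ?thesis by (simp only: G_def E_def)
qed

text \<open>The main terms are integrals of one polynomial in \<open>2 / ln y\<close>, so a
  pointwise bound on it can be integrated. The range is cut at \<open>a\<close> because for small
  \<open>y\<close> the value \<open>2 / ln y\<close> is not small and only a crude bound
  \<open>B2\<close> is available.\<close>

lemma main_term_integral_bound:
  fixes G :: "nat \<Rightarrow> real"
  assumes a: "2 \<le> a" "a \<le> x"
    and G: "G K \<ge> 0"
    and low: "\<And>y. 2 \<le> y \<Longrightarrow> y \<le> a \<Longrightarrow> \<bar>\<Sum>k<K. (- 1) ^ k * (G k * (2 / ln y) ^ k)\<bar> + G K * (2 / ln y) ^ K \<le> B2"
    and high: "\<And>y. a \<le> y \<Longrightarrow> y \<le> x \<Longrightarrow> \<bar>\<Sum>k<K. (- 1) ^ k * (G k * (2 / ln y) ^ k)\<bar> + G K * (2 / ln y) ^ K \<le> B1"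
  shows "\<bar>\<Sum>k<K. (- 2) ^ k * (G k * integral {2..x} (\<lambda>y. 1 / (ln y) ^ k))\<bar>
      + 2 ^ K * (G K * integral {2..x} (\<lambda>y. 1 / (ln y) ^ K)) \<le> a * B2 + x * B1"
proof -
  define f where "f = (\<lambda>y. \<Sum>k<K. (- 1) ^ k * (G k * (2 / ln y) ^ k))"
  define g where "g = (\<lambda>y. G K * (2 / ln y) ^ K)"
  have int: "(\<lambda>y::real. 1 / (ln y) ^ k) integrable_on {2..x}" for k
    by (intro integrable_continuous_interval continuous_intros) auto
  have cf: "continuous_on {2..} f" unfolding f_def by (intro continuous_intros) auto
  have cg: "continuous_on {2..} g" unfolding g_def by (intro continuous_intros) auto
  have If: "integral {2..x} f = (\<Sum>k<K. (- 2) ^ k * (G k * integral {2..x} (\<lambda>y. 1 / (ln y) ^ k)))"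
  proof -
    have "f = (\<lambda>y. \<Sum>k<K. ((- 2) ^ k * G k) * (1 / (ln y) ^ k))"
      unfolding f_def
      by (intro ext sum.cong refl) (simp add: power_divide power_mult_distrib[symmetric] flip: power_minus)
    then have "integral {2..x} f = (\<Sum>k<K. integral {2..x} (\<lambda>y. ((- 2) ^ k * G k) * (1 / (ln y) ^ k)))"
      using int by (simp only:) (intro integral_sum integrable_on_mult_right, auto)
    then show ?thesis by (simp only: Henstock_Kurzweil_Integration.integral_mult_right mult.assoc)
  qed
  have Ig: "integral {2..x} g = 2 ^ K * (G K * integral {2..x} (\<lambda>y. 1 / (ln y) ^ K))"
  proof -
    have "g = (\<lambda>y. (2 ^ K * G K) * (1 / (ln y) ^ K))" unfolding g_def by (simp add: power_divide mult.commute)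
    then show ?thesis by (simp only: Henstock_Kurzweil_Integration.integral_mult_right mult.assoc)
  qed
  let ?F = "\<lambda>y. \<bar>f y\<bar> + g y"
  have cont: "continuous_on {2..} ?F" by (intro continuous_intros cf cg)
  have iF: "?F integrable_on {u..v}" if "u \<ge> 2" for u v
    using that by (intro integrable_continuous_interval continuous_on_subset[OF cont]) auto
  have icf: "f integrable_on {2..x}" by (intro integrable_continuous_interval continuous_on_subset[OF cf]) auto
  have icaf: "(\<lambda>y. \<bar>f y\<bar>) integrable_on {2..x}"
    by (intro integrable_continuous_interval continuous_intros continuous_on_subset[OF cf]) auto
  have icg: "g integrable_on {2..x}" by (intro integrable_continuous_interval continuous_on_subset[OF cg]) auto
  have nonneg: "?F y \<ge> 0" if "y \<ge> 2" for y using G that by (auto simp: g_def)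
  have B2: "B2 \<ge> 0" using low[of 2] nonneg[of 2] a by (simp add: f_def g_def)
  have B1: "B1 \<ge> 0" using high[of a] nonneg[of a] a by (simp add: f_def g_def)
  have "\<bar>integral {2..x} f\<bar> \<le> integral {2..x} (\<lambda>y. \<bar>f y\<bar>)"
    using integral_norm_bound_integral[OF icf icaf] by simp
  then have "\<bar>integral {2..x} f\<bar> + integral {2..x} g \<le> integral {2..x} ?F"
    using Henstock_Kurzweil_Integration.integral_add[OF icaf icg] by simp
  also have "\<dots> = integral {2..a} ?F + integral {a..x} ?F"
    using a iF[of 2 x] by (intro Henstock_Kurzweil_Integration.integral_combine[symmetric]) auto
  also have "integral {2..a} ?F \<le> (a - 2) * B2"
  proof -
    have "integral {2..a} ?F \<le> integral {2..a} (\<lambda>_. B2)"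
      using low iF[of 2 a] by (intro integral_le) (auto simp: f_def g_def)
    then show ?thesis using a by simp
  qed
  also have "integral {a..x} ?F \<le> (x - a) * B1"
  proof -
    have "integral {a..x} ?F \<le> integral {a..x} (\<lambda>_. B1)"
      using high a iF[of a x] by (intro integral_le) (auto simp: f_def g_def)
    then show ?thesis using a by simp
  qed
  also have "(a - 2) * B2 + (x - a) * B1 \<le> a * B2 + x * B1"
    using a B1 B2 by (intro add_mono mult_right_mono) auto
  finally show ?thesis unfolding If Ig by simp
qed

text \<open>\<open>P\<close> is the last index before the density first drops below
  \<open>v\<close>. The lower Mertens bound then forces \<open>c / ln (Suc P) < v\<close>, so
  \<open>P\<close> is exponentially large in \<open>1 / v\<close>.\<close>

lemma sieve_level_exists:
  assumes c: "c > 0" and C: "C > 0"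
    and mertens: "\<And>z. z \<ge> 2 \<Longrightarrow> c / ln (real z) \<le> sieve_density z \<and> sieve_density z \<le> C / ln (real z)"
    and v: "0 < v" "v \<le> 1"
  obtains P where "v \<le> sieve_density P" "sieve_density (Suc P) < v" "exp (c / v) \<le> real P + 1"
proof -
  have "((\<lambda>z. C / ln (real z)) \<longlongrightarrow> 0) sequentially" by real_asymp
  then have "eventually (\<lambda>z. C / ln (real z) < v) sequentially" using v(1) by (rule order_tendstoD)
  with eventually_ge_at_top[of 2] have "eventually (\<lambda>z. sieve_density z < v) sequentially"
    by eventually_elim (use mertens in force)
  then have ex: "\<exists>z. sieve_density z < v" by (auto simp: eventually_at_top_linorder)
  define M where "M = (LEAST z. sieve_density z < v)"
  have M: "sieve_density M < v" unfolding M_def using ex by (rule LeastI_ex)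
  \<comment> \<open>The densities at 0 and at 1 are empty products, so \<open>v <= 1\<close>
    excludes both values of \<open>M\<close>; Mertens' bound is available from 2 on.\<close>
  have "M \<noteq> 0"
  proof
    assume "M = 0"
    then show False using M v by (simp add: sieve_density_def)
  qed
  then obtain P where P: "M = Suc P" by (cases M) auto
  have "\<not> sieve_density P < v" using not_less_Least[of P "\<lambda>z. sieve_density z < v"] P by (simp add: M_def)
  moreover have "exp (c / v) \<le> real P + 1"
  proof -
    have "M \<noteq> Suc 0" using M v by (auto simp: sieve_density_def)
    then have M2: "M \<ge> 2" using P by simp
    then have "ln (real M) > 0" by simp
    moreover have "c / ln (real M) < v" using mertens[OF M2] M by simp
    ultimately have "c / v < ln (real M)" using v by (simp add: field_simps)
    then have "exp (c / v) \<le> real M" using M2 by (metis exp_le_cancel_iff exp_ln less_imp_le of_nat_0_less_iff pos2 order_less_le_trans)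
    then show ?thesis using P by simp
  qed
  ultimately show ?thesis using M P by (intro that[of P]) auto
qed

text \<open>Combines \<open>sieve_density P <= 2 v\<close>, Mertens' bound at \<open>h\<close> and
  \<open>(h choose K) <= h ^ K / K!\<close>. For \<open>v\<close> of order \<open>1 / ln x\<close>
  and \<open>h\<close> up to order \<open>ln x * (ln ln x)^3\<close> the base of the power is of
  order at most \<open>(ln ln x)^4\<close>, so the factorial wins for \<open>K\<close> about
  \<open>(ln ln x)^5\<close>.\<close>

lemma singular_sum_truncation_le:
  assumes c: "c > 0" and mertens: "c / ln (real h) \<le> sieve_density h"
    and h: "h \<ge> 2" and P: "h \<le> P" and v: "v > 0" "sieve_density (Suc P) < v"
  shows "(\<Sum>H\<in>k_subsets h K. tuple_density P H) \<le> (2 * v * real h * ln (real h) / c) ^ K / fact K"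
proof -
  have lh: "ln (real h) > 0" using h by simp
  have "1 / 2 \<le> 1 - 1 / real (Suc P)" using h P by (simp add: field_simps)
  then have "sieve_density P * (1 / 2) \<le> sieve_density P * (1 - 1 / real (Suc P))"
    using sieve_density_pos[of P] by (intro mult_left_mono) auto
  with sieve_density_Suc_ge[of P] v have "sieve_density P \<le> 2 * v" by linarith
  then have "sieve_density P / sieve_density h \<le> 2 * v / (c / ln (real h))"
    using mertens c lh v by (intro frac_le) auto
  then have r: "sieve_density P / sieve_density h \<le> 2 * v * ln (real h) / c" by simp
  have "real (h choose K) * fact K \<le> real h ^ K"
    using binomial_fact_pow[of h K] by (metis of_nat_fact of_nat_le_iff of_nat_mult of_nat_power)
  then have b: "real (h choose K) \<le> real h ^ K / fact K" by (simp add: field_simps)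
  have "(\<Sum>H\<in>k_subsets h K. tuple_density P H) \<le> real (h choose K) * (sieve_density P / sieve_density h) ^ K"
    by (rule sum_tuple_density_le[OF P])
  also have "\<dots> \<le> (real h ^ K / fact K) * (2 * v * ln (real h) / c) ^ K"
    using r b sieve_density_pos[of P] sieve_density_pos[of h]
    by (intro mult_mono power_mono) (auto intro: less_imp_le)
  also have "\<dots> = (2 * v * real h * ln (real h) / c) ^ K / fact K"
    by (simp add: power_mult_distrib power_divide mult_ac)
  finally show ?thesis .
qed

text \<open>Three contributions: the range of \<open>y\<close> below \<open>sqrt x\<close>, where
  the shortness of the range saves; the range above, where the random sieve applies with density
  near \<open>2 / ln y\<close>; and the error terms of the conjecture.\<close>

lemma parity_correlation_explicit:
  fixes x :: real
  assumes c: "c > 0" and C': "C' > 0"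
    and mertens: "\<And>z. z \<ge> 2 \<Longrightarrow> c / ln (real z) \<le> sieve_density z \<and> sieve_density z \<le> C' / ln (real z)"
    and est: "tuple_estimate \<epsilon> C x K" and C: "C > 0"
    and x: "x \<ge> exp 4" and h: "h \<ge> 2" "real h \<le> (ln x)\<^sup>2"
    and Z: "2 * real h + 2 \<le> exp (c * ln x / 4)"
  shows "\<bar>\<Sum>n\<in>{1..\<lfloor>x\<rfloor>}. (- 1) ^ card (prime_window h n)\<bar>
    \<le> sqrt x * ((real K + 1) * (2 * real h * ln x) ^ K)
      + x * (ln x / (2 * real h) + 2 * ((8 * real h * ln (real h) / (c * ln x)) ^ K / fact K)
             + 4 * real K ^ 3 * real h ^ K / exp (c * ln x / 4))
      + (real K + 1) * (2 * real h) ^ K * (C * x powr (1 - \<epsilon>))"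
proof -
  let ?G = "singular_sum h" and ?Z = "exp (c * ln x / 4)"
  define B1 where "B1 = ln x / (2 * real h) + 2 * ((8 * real h * ln (real h) / (c * ln x)) ^ K / fact K)
             + 4 * real K ^ 3 * real h ^ K / ?Z"
  define B2 where "B2 = (real K + 1) * (2 * real h * ln x) ^ K"
  have x0: "x > 0" using x exp_gt_zero[of "4::real"] by linarith
  have lnx: "ln x \<ge> 4" using x x0 by (simp add: ln_ge_iff)
  have lnsx: "ln (sqrt x) = ln x / 2" using x0 by (simp add: ln_sqrt)
  have "exp (4::real) \<ge> 5" using exp_ge_add_one_self[of "4::real"] by simp
  then have x5: "x \<ge> 5" using x by linarith
  have sx: "2 \<le> sqrt x" "sqrt x \<le> x"
    using x5 by (auto intro!: real_le_rsqrt real_le_lsqrt simp: power2_eq_square)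
  \<comment> \<open>Since \<open>ln y >= ln x / 2\<close>, the level belonging to
    \<open>2 / ln y\<close> is at least about \<open>exp (c * ln x / 4)\<close>, uniformly in
    \<open>y\<close>.\<close>
  have level: "\<exists>P. 2 / ln y \<le> sieve_density P \<and> sieve_density (Suc P) < 2 / ln y \<and> ?Z / 2 \<le> real P \<and> h \<le> P"
    if y: "sqrt x \<le> y" "y \<le> x" for y
  proof -
    have y0: "y > 0" using y sx by linarith
    have ly: "ln x / 2 \<le> ln y" using lnsx y(1) sx y0 by (metis ln_le_cancel_iff order_less_le_trans zero_less_numeral)
    obtain P where P: "2 / ln y \<le> sieve_density P" "sieve_density (Suc P) < 2 / ln y"
        "exp (c / (2 / ln y)) \<le> real P + 1"
      using sieve_level_exists[OF c C' mertens, of "2 / ln y"] ly lnx by auto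
    have "?Z \<le> exp (c / (2 / ln y))" using ly c by simp
    then have PZ: "?Z \<le> real P + 1" using P(3) by linarith
    have "?Z \<ge> 2" using order_trans[OF _ Z, of 2] by simp
    then have "?Z / 2 \<le> real P" using PZ by linarith
    moreover have "real h \<le> real P" using order_trans[OF Z PZ] by simp
    ultimately show ?thesis using P by auto
  qed
  \<comment> \<open>For small \<open>y\<close> the level belonging to \<open>2 / ln x\<close> is
    used instead: \<open>2 / ln y\<close> exceeds \<open>2 / ln x\<close> by a factor of at most
    \<open>2 * ln x\<close>, because \<open>ln y >= 1/2\<close>.\<close>
  have low: "\<bar>\<Sum>k<K. (- 1) ^ k * (?G k * (2 / ln y) ^ k)\<bar> + ?G K * (2 / ln y) ^ K \<le> B2"
    if y: "2 \<le> y" "y \<le> sqrt x" for y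
  proof -
    obtain P where P: "2 / ln x \<le> sieve_density P" "sieve_density (Suc P) < 2 / ln x" "h \<le> P"
      using level[of x] sx by auto
    have "ln y \<ge> ln 2" using y by simp
    then have ly: "ln y \<ge> 1 / 2" using ln2_ge_two_thirds by linarith
    have bound: "?G k * (2 / ln y) ^ k \<le> (2 * real h * ln x) ^ K" if k: "k \<le> K" for k
    proof -
      have "2 / ln y \<le> (2 / ln x) * (2 * ln x)" using ly lnx by (simp add: field_simps)
      then have "(2 / ln y) ^ k \<le> ((2 / ln x) * (2 * ln x)) ^ k" using ly by (intro power_mono) auto
      then have "?G k * (2 / ln y) ^ k \<le> ?G k * ((2 / ln x) * (2 * ln x)) ^ k"
        by (intro mult_left_mono singular_sum_nonneg)
      also have "\<dots> = (?G k * (2 / ln x) ^ k) * (2 * ln x) ^ k" by (simp only: power_mult_distrib mult.assoc)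
      also have "\<dots> \<le> real h ^ k * (2 * ln x) ^ k"
      proof (rule mult_right_mono)
        have "?G k * (2 / ln x) ^ k \<le> real (h choose k)"
          by (rule singular_sum_le_choose[OF P(3)]) (use P h lnx in auto)
        also have "\<dots> \<le> real h ^ k" by (rule choose_le_power)
        finally show "?G k * (2 / ln x) ^ k \<le> real h ^ k" .
      qed (use lnx in simp)
      also have "\<dots> = (2 * real h * ln x) ^ k" by (simp add: power_mult_distrib mult_ac)
      also have "\<dots> \<le> (2 * real h * ln x) ^ K"
      proof (rule power_increasing[OF k])
        have "1 * 1 \<le> (2 * real h) * ln x" using h lnx by (intro mult_mono) auto
        then show "1 \<le> 2 * real h * ln x" by simp
      qed
      finally show ?thesis .
    qed
    have nn: "?G k * (2 / ln y) ^ k \<ge> 0" for k using ly by (intro mult_nonneg_nonneg singular_sum_nonneg) auto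
    have "\<bar>\<Sum>k<K. (- 1) ^ k * (?G k * (2 / ln y) ^ k)\<bar> \<le> (\<Sum>k<K. \<bar>(- 1) ^ k * (?G k * (2 / ln y) ^ k)\<bar>)"
      by (rule sum_abs)
    also have "\<dots> \<le> (\<Sum>k<K. (2 * real h * ln x) ^ K)"
    proof (rule sum_mono)
      fix k assume "k \<in> {..<K}"
      have "\<bar>(- 1) ^ k * (?G k * (2 / ln y) ^ k)\<bar> = ?G k * (2 / ln y) ^ k"
        using nn[of k] by (simp only: abs_mult[of "(- 1) ^ k"] power_abs abs_neg_one power_one abs_of_nonneg mult_1)
      then show "\<bar>(- 1) ^ k * (?G k * (2 / ln y) ^ k)\<bar> \<le> (2 * real h * ln x) ^ K"
        using bound[of k] \<open>k \<in> {..<K}\<close> by simp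
    qed
    also have "\<dots> = real K * (2 * real h * ln x) ^ K" by simp
    finally have "\<bar>\<Sum>k<K. (- 1) ^ k * (?G k * (2 / ln y) ^ k)\<bar> + ?G K * (2 / ln y) ^ K
        \<le> real K * (2 * real h * ln x) ^ K + (2 * real h * ln x) ^ K"
      using bound[of K] by simp
    then show ?thesis by (simp add: B2_def distrib_right)
  qed
  have high: "\<bar>\<Sum>k<K. (- 1) ^ k * (?G k * (2 / ln y) ^ k)\<bar> + ?G K * (2 / ln y) ^ K \<le> B1"
    if y: "sqrt x \<le> y" "y \<le> x" for y
  proof -
    have y0: "y > 0" using y sx by linarith
    have ly: "ln x / 2 \<le> ln y" using lnsx y(1) sx y0 by (metis ln_le_cancel_iff order_less_le_trans zero_less_numeral)
    have ly': "ln y \<le> ln x" using y y0 by simp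
    obtain P where P: "2 / ln y \<le> sieve_density P" "sieve_density (Suc P) < 2 / ln y" "?Z / 2 \<le> real P" "h \<le> P"
      using level[OF y] by auto
    let ?v = "2 / ln y" and ?V = "\<Sum>H\<in>k_subsets h K. tuple_density P H"
    have v0: "?v > 0" using ly lnx by simp
    have v4: "?v \<le> 4 / ln x" using ly lnx by (simp add: field_simps)
    have lh: "ln (real h) > 0" using h by simp
    have "?V \<le> (2 * ?v * real h * ln (real h) / c) ^ K / fact K"
      using mertens[OF h(1)] P h v0 by (intro singular_sum_truncation_le c) auto
    also have "\<dots> \<le> (2 * (4 / ln x) * real h * ln (real h) / c) ^ K / fact K"
      using v4 v0 lh c by (intro divide_right_mono power_mono mult_right_mono mult_left_mono) auto
    also have "2 * (4 / ln x) * real h * ln (real h) / c = 8 * real h * ln (real h) / (c * ln x)"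
      by simp
    finally have V: "?V \<le> (8 * real h * ln (real h) / (c * ln x)) ^ K / fact K" .
    have GV: "?G K * ?v ^ K \<le> ?V"
      by (rule singular_sum_le) (use P h v0 in auto)
    have "1 / (real h * ?v) = ln y / (2 * real h)" by simp
    also have "\<dots> \<le> ln x / (2 * real h)" using ly' h by (intro divide_right_mono) auto
    finally have one: "1 / (real h * ?v) \<le> ln x / (2 * real h)" .
    have "2 * real K ^ 3 * real h ^ K / real P \<le> 2 * real K ^ 3 * real h ^ K / (?Z / 2)"
      using P(3) h P(4) by (intro divide_left_mono) auto
    then have err: "2 * real K ^ 3 * real h ^ K / real P \<le> 4 * real K ^ 3 * real h ^ K / ?Z" by simp
    have "\<bar>\<Sum>k<K. (- 1) ^ k * (?G k * ?v ^ k)\<bar> \<le> 1 / (real h * ?v) + ?V + 2 * real K ^ 3 * real h ^ K / real P"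
      by (rule alternating_singular_sum_bound) (use P h v0 in auto)
    then show ?thesis using GV V one err unfolding B1_def by linarith
  qed
  have "\<bar>\<Sum>k<K. (- 2) ^ k * (?G k * integral {2..x} (\<lambda>y. 1 / (ln y) ^ k))\<bar>
      + 2 ^ K * (?G K * integral {2..x} (\<lambda>y. 1 / (ln y) ^ K)) \<le> sqrt x * B2 + x * B1"
    by (rule main_term_integral_bound[OF sx singular_sum_nonneg low high])
  moreover have "\<bar>\<Sum>n\<in>{1..\<lfloor>x\<rfloor>}. (- 1) ^ card (prime_window h n)\<bar>
    \<le> \<bar>\<Sum>k<K. (- 2) ^ k * (?G k * integral {2..x} (\<lambda>y. 1 / (ln y) ^ k))\<bar>
      + 2 ^ K * (?G K * integral {2..x} (\<lambda>y. 1 / (ln y) ^ K))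
      + (real K + 1) * (2 * real h) ^ K * (C * x powr (1 - \<epsilon>))"
    using h by (intro parity_correlation_expansion[OF est C]) auto
  ultimately show ?thesis unfolding B1_def B2_def by linarith
qed

section \<open>Choice of the truncation order\<close>

lemma power_le_exp_mult_fact: "(t::real) \<ge> 0 \<Longrightarrow> t ^ K \<le> exp t * fact K"
proof -
  assume t: "t \<ge> 0"
  have "(\<Sum>n\<in>{K}. t ^ n /\<^sub>R fact n) \<le> (\<Sum>n. t ^ n /\<^sub>R fact n)"
    using t by (intro sum_le_suminf summable_exp_generic) auto
  then have "t ^ K / fact K \<le> exp t" by (simp add: exp_def divide_inverse mult.commute)
  then show ?thesis by (simp add: field_simps)
qed

text \<open>Let \<open>K\<close> be the exponent, so \<open>K >= L^5 / 2\<close>. From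
  \<open>K! >= (K / e) ^ K\<close> and \<open>L >= 4 e A\<close> the quotient is at most
  \<open>(1/2) ^ K\<close>, and \<open>2 ^ K >= K\<close>.\<close>

lemma power_over_fact_small:
  fixes A L :: real
  assumes A: "A > 0" and L: "L \<ge> 4 * exp 1 * A" "L \<ge> 2"
  shows "(A * L ^ 4) ^ nat \<lfloor>L ^ 5\<rfloor> / fact (nat \<lfloor>L ^ 5\<rfloor>) \<le> 2 / L ^ 5"
proof -
  define K where "K = nat \<lfloor>L ^ 5\<rfloor>"
  have L5: "L ^ 5 \<ge> 2" using L(2) power_mono[of 2 L 5] by simp
  have K1: "real K \<ge> L ^ 5 - 1" using L5 unfolding K_def by linarith
  then have K: "real K \<ge> L ^ 5 / 2" using L5 by linarith
  then have K0: "real K > 0" using L5 by linarith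
  have "real K ^ K \<le> exp (real K) * fact K" by (rule power_le_exp_mult_fact) simp
  also have "exp (real K) = exp 1 ^ K" using exp_of_nat_mult[of K "1::real"] by simp
  finally have f: "1 / fact K \<le> (exp 1 / real K) ^ K"
    using K0 by (simp add: power_divide field_simps)
  have "(A * L ^ 4) ^ K / fact K = (A * L ^ 4) ^ K * (1 / fact K)" by simp
  also have "\<dots> \<le> (A * L ^ 4) ^ K * (exp 1 / real K) ^ K"
    using A L f by (intro mult_left_mono) auto
  also have "\<dots> = (A * L ^ 4 * exp 1 / real K) ^ K" by (simp add: power_mult_distrib power_divide)
  also have "\<dots> \<le> (1 / 2) ^ K"
  proof (rule power_mono)
    have "(4 * exp 1 * A) * L ^ 4 \<le> L * L ^ 4" using L by (intro mult_right_mono) auto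
    also have "\<dots> = L ^ 5" by (simp add: power_Suc[symmetric] del: power_Suc)
    finally have "2 * (A * L ^ 4 * exp 1) \<le> real K" using K by (simp add: mult_ac)
    then show "A * L ^ 4 * exp 1 / real K \<le> 1 / 2" using K0 by (simp add: field_simps)
  qed (use A L in auto)
  also have "\<dots> \<le> 1 / real K"
  proof -
    have "real K \<le> 2 ^ K" using less_exp[of K] by (metis less_imp_le of_nat_le_iff of_nat_numeral of_nat_power)
    then show ?thesis using K0 by (simp only: power_divide power_one frac_le)
  qed
  also have "\<dots> \<le> 1 / (L ^ 5 / 2)" using K K0 L5 L(2) by (intro divide_left_mono mult_pos_pos) auto
  finally show ?thesis by (simp add: K_def)
qed

text \<open>With \<open>L = ln (ln x)\<close>, \<open>K\<close> is the largest order that the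
  conjecture allows. The powers \<open>b ^ K\<close> with \<open>b <= (ln x)^4\<close> are at most
  \<open>exp (4 * L ^ 6)\<close>, which is smaller than any fixed power of \<open>x\<close> and
  hence absorbed by the power savings.\<close>

lemma parity_correlation_bound:
  assumes HL: "quantitative_Hardy_Littlewood"
  shows "eventually (\<lambda>x::real. \<forall>h::nat. 2 \<le> h \<longrightarrow> real h \<le> 2 * ln (ln x) ^ 3 * ln x \<longrightarrow>
    \<bar>\<Sum>n\<in>{1..\<lfloor>x\<rfloor>}. (- 1) ^ card (prime_window h n)\<bar> \<le> x * (ln x / (2 * real h) + 1 / ln (ln x) ^ 4)) at_top"
proof -
  obtain c C' where c: "c > 0" and C': "C' > 0" and mertens:
    "\<And>z. z \<ge> 2 \<Longrightarrow> c / ln (real z) \<le> sieve_density z \<and> sieve_density z \<le> C' / ln (real z)"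
    using mertens_third[OF HL] by blast
  from HL obtain \<epsilon> C where \<epsilon>: "\<epsilon> > 0" and C: "C > 0" and HL':
    "\<And>x k (H::int set). x \<ge> 10 \<Longrightarrow> real k \<le> (ln (ln x)) ^ 5 \<Longrightarrow> finite H \<Longrightarrow> card H = k \<Longrightarrow>
       (\<forall>h\<in>H. 0 \<le> h \<and> real_of_int h \<le> (ln x)\<^sup>2) \<Longrightarrow>
        \<bar>(\<Sum>n\<in>{1..\<lfloor>x\<rfloor>}. \<Prod>h\<in>H. indicat_real {p::int. prime p} (n + h))
           - singular_series H * integral {2..x} (\<lambda>y. 1 / (ln y) ^ k)\<bar>
        \<le> C * x powr (1 - \<epsilon>)"
    unfolding quantitative_Hardy_Littlewood_def by blast
  have "eventually (\<lambda>x::real. x \<ge> exp 4) at_top" by (rule eventually_ge_at_top)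
  \<comment> \<open>\<open>32 / c\<close> is the constant \<open>A\<close> of
    \<open>power_over_fact_small\<close>, obtained from \<open>h <= 2 L^3 ln x\<close> and
    \<open>ln h <= 2 L\<close>. Seven errors \<open>1 / L ^ 5\<close> are collected at the end into
    \<open>1 / L ^ 4\<close>, which asks for \<open>L >= 7\<close>.\<close>
  moreover have "eventually (\<lambda>x::real. ln (ln x) \<ge> 4 * exp 1 * (32 / c) + 7) at_top" by real_asymp
  moreover have "eventually (\<lambda>x::real. 4 * ln (ln x) ^ 3 \<le> ln x) at_top" by real_asymp
  moreover have "eventually (\<lambda>x::real. 2 * (ln x)\<^sup>2 + 2 \<le> exp (c * ln x / 4)) at_top"
    using c by real_asymp
  moreover have "eventually (\<lambda>x::real. 2 * ln (ln x) ^ 10 * exp (4 * ln (ln x) ^ 6) \<le> sqrt x) at_top"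
    by real_asymp
  moreover have "eventually (\<lambda>x::real. 4 * ln (ln x) ^ 20 * exp (4 * ln (ln x) ^ 6) \<le> exp (c * ln x / 4)) at_top"
    using c by real_asymp
  moreover have "eventually (\<lambda>x::real. 2 * ln (ln x) ^ 10 * exp (4 * ln (ln x) ^ 6) * C \<le> x powr \<epsilon>) at_top"
    using \<epsilon> by real_asymp
  ultimately show ?thesis
  proof eventually_elim
    case (elim x)
    define L where "L = ln (ln x)"
    define K where "K = nat \<lfloor>L ^ 5\<rfloor>"
    define W where "W = exp (4 * L ^ 6)"
    let ?Z = "exp (c * ln x / 4)"
    have x0: "x > 0" using elim(1) exp_gt_zero[of "4::real"] by linarith
    have x5: "x \<ge> 10"
    proof -
      have "(1 + 4 + 4\<^sup>2 / 2 :: real) \<le> exp 4" using exp_lower_Taylor_quadratic[of "4::real"] by simp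
      then show ?thesis using elim(1) by simp
    qed
    have lnx: "ln x \<ge> 4" using elim(1) x0 by (simp add: ln_ge_iff)
    have cpos: "4 * exp 1 * (32 / c) > 0" using c by simp
    then have L7: "L \<ge> 7" and LA: "L \<ge> 4 * exp 1 * (32 / c)" using elim(2) by (auto simp: L_def)
    have W: "W > 0" by (simp add: W_def)
    have eL: "exp L = ln x" using lnx by (simp add: L_def)
    have L51: "L ^ 5 \<ge> 1" using L7 by (intro one_le_power) auto
    have K: "real K \<le> L ^ 5" using L51 unfolding K_def by linarith
    have K1: "real K + 1 \<le> 2 * L ^ 5" using K L51 by linarith
    have K3: "real K ^ 3 \<le> L ^ 15" using power_mono[OF K, of 3] by (simp add: power_mult[symmetric])
    have est: "tuple_estimate \<epsilon> C x K"
      unfolding tuple_estimate_def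
    proof (intro allI impI)
      fix H :: "int set"
      assume H: "finite H" "card H \<le> K" "\<forall>h\<in>H. 0 \<le> h \<and> real_of_int h \<le> (ln x)\<^sup>2"
      have "real (card H) \<le> real K" using H(2) by simp
      also note K
      finally have "real (card H) \<le> (ln (ln x)) ^ 5" by (simp add: L_def)
      from HL'[OF x5 this H(1) refl H(3)] show "\<bar>(\<Sum>n\<in>{1..\<lfloor>x\<rfloor>}. \<Prod>h\<in>H. indicat_real {p::int. prime p} (n + h))
           - singular_series H * integral {2..x} (\<lambda>y. 1 / (ln y) ^ card H)\<bar> \<le> C * x powr (1 - \<epsilon>)" .
    qed
    have powW: "b ^ K \<le> W" if b: "0 \<le> b" "b \<le> (ln x) ^ 4" for b
    proof -
      have "b ^ K \<le> (exp (4 * L)) ^ K"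
        using b eL by (intro power_mono) (auto simp: exp_of_nat_mult[of 4 L, simplified])
      also have "\<dots> = exp (real K * (4 * L))" by (rule exp_of_nat_mult[symmetric])
      also have "\<dots> \<le> exp (L ^ 5 * (4 * L))" using K L7 by (simp add: mult_right_mono)
      also have "L ^ 5 * (4 * L) = 4 * L ^ 6" by (simp add: eval_nat_numeral)
      finally show ?thesis by (simp add: W_def)
    qed
    show ?case
    proof (intro allI impI)
      fix h :: nat assume h2: "2 \<le> h" and hle: "real h \<le> 2 * ln (ln x) ^ 3 * ln x"
      have hL: "real h \<le> 2 * L ^ 3 * ln x" using hle by (simp add: L_def)
      have "2 * (2 * L ^ 3 * ln x) \<le> ln x * ln x"
        using elim(3) lnx mult_right_mono[of "4 * L ^ 3" "ln x" "ln x"] by (simp add: L_def)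
      then have h2sq: "2 * real h \<le> (ln x)\<^sup>2" using hL by (simp add: power2_eq_square)
      then have hsq: "real h \<le> (ln x)\<^sup>2" by simp
      have lnh: "ln (real h) \<le> 2 * L"
      proof -
        have "ln (real h) \<le> ln ((ln x)\<^sup>2)" using hsq h2 lnx by (subst ln_le_cancel_iff) auto
        also have "\<dots> = 2 * L" using lnx by (simp add: L_def ln_realpow)
        finally show ?thesis .
      qed
      have lnh0: "ln (real h) > 0" using h2 by simp
      have l24: "(ln x)\<^sup>2 \<le> (ln x) ^ 4" using lnx by (intro power_increasing) auto
      have Z: "2 * real h + 2 \<le> ?Z" using elim(4) hsq by linarith
      have "\<bar>\<Sum>n\<in>{1..\<lfloor>x\<rfloor>}. (- 1) ^ card (prime_window h n)\<bar>
        \<le> sqrt x * ((real K + 1) * (2 * real h * ln x) ^ K)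
          + x * (ln x / (2 * real h) + 2 * ((8 * real h * ln (real h) / (c * ln x)) ^ K / fact K)
                 + 4 * real K ^ 3 * real h ^ K / ?Z)
          + (real K + 1) * (2 * real h) ^ K * (C * x powr (1 - \<epsilon>))"
        by (rule parity_correlation_explicit[OF c C' mertens est C elim(1) h2 hsq Z])
      moreover have "sqrt x * ((real K + 1) * (2 * real h * ln x) ^ K) \<le> x * (1 / L ^ 5)"
      proof -
        have "2 * real h * ln x \<le> (ln x)\<^sup>2 * ln x" using h2sq lnx by (intro mult_right_mono) auto
        also have "\<dots> = (ln x) ^ 3" by (simp add: eval_nat_numeral)
        also have "\<dots> \<le> (ln x) ^ 4" using lnx by (intro power_increasing) auto
        finally have "(2 * real h * ln x) ^ K \<le> W" using lnx by (intro powW) auto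
        then have "sqrt x * ((real K + 1) * (2 * real h * ln x) ^ K) \<le> sqrt x * (2 * L ^ 5 * W)"
          using K1 W L7 x5 lnx by (intro mult_left_mono mult_mono zero_le_power mult_nonneg_nonneg) auto
        also have "\<dots> = sqrt x * ((2 * L ^ 10 * W) / L ^ 5)" using L7 by (simp add: field_simps eval_nat_numeral)
        also have "\<dots> \<le> sqrt x * (sqrt x / L ^ 5)"
          using elim(5) L7 x0 by (intro mult_left_mono divide_right_mono) (auto simp: W_def L_def)
        also have "\<dots> = x * (1 / L ^ 5)" using x0 by simp
        finally show ?thesis .
      qed
      moreover have "(8 * real h * ln (real h) / (c * ln x)) ^ K / fact K \<le> 2 / L ^ 5"
      proof -
        have "8 * real h * ln (real h) / (c * ln x) \<le> 8 * (2 * L ^ 3 * ln x) * (2 * L) / (c * ln x)"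
          using hL lnh lnh0 c lnx L7 by (intro divide_right_mono mult_mono) auto
        also have "\<dots> = (32 / c) * L ^ 4" using lnx c by (simp add: field_simps eval_nat_numeral)
        finally have "(8 * real h * ln (real h) / (c * ln x)) ^ K / fact K \<le> ((32 / c) * L ^ 4) ^ K / fact K"
          using lnh0 c lnx by (intro divide_right_mono power_mono) auto
        also have "\<dots> \<le> 2 / L ^ 5"
          unfolding K_def using LA L7 c by (intro power_over_fact_small) auto
        finally show ?thesis .
      qed
      moreover have "4 * real K ^ 3 * real h ^ K / ?Z \<le> 1 / L ^ 5"
      proof -
        have "real h ^ K \<le> W" using hsq l24 by (intro powW) auto
        then have "4 * real K ^ 3 * real h ^ K \<le> 4 * L ^ 15 * W"
          using K3 W L7 by (intro mult_mono) auto
        also have "\<dots> = (4 * L ^ 20 * W) / L ^ 5" using L7 by (simp add: field_simps eval_nat_numeral)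
        also have "\<dots> \<le> ?Z / L ^ 5" using elim(6) L7 by (intro divide_right_mono) (auto simp: W_def L_def)
        finally have "4 * real K ^ 3 * real h ^ K / ?Z \<le> (?Z / L ^ 5) / ?Z" by (intro divide_right_mono) auto
        then show ?thesis by simp
      qed
      moreover have "(real K + 1) * (2 * real h) ^ K * (C * x powr (1 - \<epsilon>)) \<le> x * (1 / L ^ 5)"
      proof -
        have "(2 * real h) ^ K \<le> W" using h2sq l24 by (intro powW) auto
        then have "(real K + 1) * (2 * real h) ^ K * (C * x powr (1 - \<epsilon>)) \<le> (2 * L ^ 5) * W * (C * x powr (1 - \<epsilon>))"
          using K1 W L7 C by (intro mult_right_mono mult_mono) auto
        also have "\<dots> = (2 * L ^ 10 * W * C) / L ^ 5 * x powr (1 - \<epsilon>)" using L7 by (simp add: field_simps eval_nat_numeral)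
        also have "\<dots> \<le> x powr \<epsilon> / L ^ 5 * x powr (1 - \<epsilon>)"
          using elim(7) L7 by (intro mult_right_mono divide_right_mono) (auto simp: W_def L_def)
        also have "\<dots> = (x powr \<epsilon> * x powr (1 - \<epsilon>)) / L ^ 5" by simp
        also have "x powr \<epsilon> * x powr (1 - \<epsilon>) = x" using x0 by (simp add: powr_add[symmetric])
        finally show ?thesis by simp
      qed
      ultimately have "\<bar>\<Sum>n\<in>{1..\<lfloor>x\<rfloor>}. (- 1) ^ card (prime_window h n)\<bar>
        \<le> x * (1 / L ^ 5) + x * (ln x / (2 * real h) + 2 * (2 / L ^ 5) + 1 / L ^ 5) + x * (1 / L ^ 5)"
        using x0 by (smt (verit) mult_left_mono)
      also have "\<dots> = x * (ln x / (2 * real h) + 7 / L ^ 5)" by (simp add: algebra_simps)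
      also have "\<dots> \<le> x * (ln x / (2 * real h) + 1 / L ^ 4)"
      proof (intro mult_left_mono add_left_mono)
        have "7 / L ^ 5 \<le> L / L ^ 5" using L7 by (intro divide_right_mono) auto
        also have "\<dots> = 1 / L ^ 4" using L7 by (simp add: eval_nat_numeral)
        finally show "7 / L ^ 5 \<le> 1 / L ^ 4" .
      qed (use x0 in auto)
      finally show "\<bar>\<Sum>n\<in>{1..\<lfloor>x\<rfloor>}. (- 1) ^ card (prime_window h n)\<bar>
        \<le> x * (ln x / (2 * real h) + 1 / ln (ln x) ^ 4)" by (simp add: L_def)
    qed
  qed
qed

section \<open>Cancellation in the parity\<close>

lemma sum_shift_bound:
  fixes g :: "nat \<Rightarrow> real"
  assumes "\<And>n. \<bar>g n\<bar> \<le> 1"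
  shows "\<bar>(\<Sum>n=1..X. g (n + m)) - (\<Sum>n=1..X. g n)\<bar> \<le> 2 * real m"
proof (induction m)
  case (Suc m)
  have "(\<Sum>n=1..X. g (n + Suc m)) - (\<Sum>n=1..X. g (n + m)) = g (Suc X + m) - g (1 + m)"
    by (induction X) auto
  then have "\<bar>(\<Sum>n=1..X. g (n + Suc m)) - (\<Sum>n=1..X. g (n + m))\<bar> \<le> 2"
    using assms[of "Suc X + m"] assms[of "1 + m"] by linarith
  with Suc show ?case by simp
qed simp

lemma sum_differences_le:
  fixes R :: "nat \<Rightarrow> real"
  assumes "\<And>d. R d \<ge> 0" "i < J"
  shows "(\<Sum>j<J. if i = j then r else R (nat \<bar>int i - int j\<bar>)) \<le> r + 2 * (\<Sum>d=1..J. R d)"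
proof -
  have split: "{..<J} = insert i ({..<i} \<union> {i<..<J})" using assms(2) by auto
  have "(\<Sum>j<J. if i = j then r else R (nat \<bar>int i - int j\<bar>))
      = r + ((\<Sum>j<i. R (i - j)) + (\<Sum>j\<in>{i<..<J}. R (j - i)))"
  proof -
    have "(\<Sum>j<i. if i = j then r else R (nat \<bar>int i - int j\<bar>)) = (\<Sum>j<i. R (i - j))"
      by (intro sum.cong refl) (auto simp: nat_diff_distrib intro!: arg_cong[of _ _ R])
    moreover have "(\<Sum>j\<in>{i<..<J}. if i = j then r else R (nat \<bar>int i - int j\<bar>)) = (\<Sum>j\<in>{i<..<J}. R (j - i))"
      by (intro sum.cong refl) (auto simp: nat_diff_distrib intro!: arg_cong[of _ _ R])
    ultimately show ?thesis unfolding split by (subst sum.insert, simp, simp, subst sum.union_disjoint) auto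
  qed
  also have "(\<Sum>j<i. R (i - j)) = (\<Sum>d=1..i. R d)"
    by (rule sum.reindex_bij_witness[of _ "\<lambda>d. i - d" "\<lambda>j. i - j"]) auto
  also have "\<dots> \<le> (\<Sum>d=1..J. R d)" using assms by (intro sum_mono2) auto
  also have "(\<Sum>j\<in>{i<..<J}. R (j - i)) = (\<Sum>d\<in>{1..<J - i}. R d)"
    by (rule sum.reindex_bij_witness[of _ "\<lambda>d. i + d" "\<lambda>j. j - i"]) auto
  also have "\<dots> \<le> (\<Sum>d=1..J. R d)" using assms by (intro sum_mono2) auto
  finally show ?thesis by simp
qed

text \<open>The sum is averaged over \<open>J\<close> shifts by multiples of \<open>q\<close>;
  Cauchy-Schwarz and expansion of the square then bring in the correlations, with at most
  \<open>X\<close> for each diagonal term. The spacing \<open>q\<close> avoids the short shifts,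
  where the parity is still strongly correlated. Moving the range of summation costs the terms with
  \<open>J ^ 2 * q\<close> and \<open>J ^ 3 * q\<close>.\<close>

lemma van_der_Corput_bound:
  fixes s R :: "nat \<Rightarrow> real"
  assumes s: "\<And>n. \<bar>s n\<bar> \<le> 1" and R: "\<And>d. R d \<ge> 0"
    and corr: "\<And>d. 1 \<le> d \<Longrightarrow> d \<le> J \<Longrightarrow> \<bar>\<Sum>n=1..X. s n * s (n + d * q)\<bar> \<le> R d"
  shows "real J * \<bar>\<Sum>n=1..X. s n\<bar>
    \<le> sqrt (real X * (real J * (real X + 2 * (\<Sum>d=1..J. R d)) + 2 * real J ^ 3 * real q)) + 2 * real J ^ 2 * real q"
proof -
  define S where "S = (\<Sum>n=1..X. s n)"
  define D where "D = (\<Sum>j<J. \<Sum>n=1..X. s (n + j * q))"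
  have sh: "\<bar>(\<Sum>n=1..X. s (n + j * q)) - S\<bar> \<le> 2 * real J * real q" if "j < J" for j
  proof -
    have "\<bar>(\<Sum>n=1..X. s (n + j * q)) - S\<bar> \<le> 2 * real (j * q)"
      unfolding S_def by (rule sum_shift_bound[OF s])
    also have "\<dots> \<le> 2 * real J * real q" using that by (simp add: mult_right_mono)
    finally show ?thesis .
  qed
  have "\<bar>D - real J * S\<bar> = \<bar>\<Sum>j<J. (\<Sum>n=1..X. s (n + j * q)) - S\<bar>" by (simp add: D_def sum_subtractf)
  also have "\<dots> \<le> (\<Sum>j<J. 2 * real J * real q)"
    using sh by (intro order_trans[OF sum_abs] sum_mono) auto
  finally have DS: "\<bar>D - real J * S\<bar> \<le> 2 * real J ^ 2 * real q" by (simp add: power2_eq_square)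
  have pair: "(\<Sum>n=1..X. s (n + i * q) * s (n + j * q))
      \<le> (if i = j then real X else R (nat \<bar>int i - int j\<bar>)) + 2 * real J * real q"
    if ij: "i < J" "j < J" for i j
  proof -
    have ord: "(\<Sum>n=1..X. s (n + i * q) * s (n + j * q)) \<le> R (j - i) + 2 * real J * real q"
      if "i < j" "j < J" for i j
    proof -
      let ?g = "\<lambda>n. s n * s (n + (j - i) * q)"
      have "\<bar>?g n\<bar> \<le> 1" for n using s[of n] s[of "n + (j - i) * q"] by (simp add: abs_mult mult_le_one)
      then have "\<bar>(\<Sum>n=1..X. ?g (n + i * q)) - (\<Sum>n=1..X. ?g n)\<bar> \<le> 2 * real (i * q)"
        by (rule sum_shift_bound)
      moreover have "2 * real (i * q) \<le> 2 * real J * real q" using that by (simp add: mult_right_mono)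
      moreover have "\<bar>\<Sum>n=1..X. ?g n\<bar> \<le> R (j - i)" using that by (intro corr) auto
      moreover have "n + i * q + (j - i) * q = n + j * q" for n
        using that by (simp add: add.assoc add_mult_distrib[symmetric])
      ultimately show ?thesis by simp
    qed
    consider "i = j" | "i < j" | "j < i" by linarith
    then show ?thesis
    proof cases
      case 1
      have "(\<Sum>n=1..X. s (n + i * q) * s (n + j * q)) \<le> (\<Sum>n=1..X. 1)"
        using s by (intro sum_mono) (simp add: 1 abs_square_le_1 power2_eq_square[symmetric])
      then show ?thesis using 1 by (simp add: add_increasing2)
    next
      case 2
      then have "nat \<bar>int i - int j\<bar> = j - i" by simp
      then show ?thesis using ord[OF 2 ij(2)] 2 by simp
    next
      case 3
      then have "nat \<bar>int i - int j\<bar> = i - j" by simp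
      then show ?thesis using ord[OF 3 ij(1)] 3 by (simp add: mult.commute)
    qed
  qed
  have "(\<Sum>n=1..X. (\<Sum>j<J. s (n + j * q))\<^sup>2) = (\<Sum>n=1..X. \<Sum>i<J. \<Sum>j<J. s (n + i * q) * s (n + j * q))"
    by (simp add: power2_eq_square sum_product)
  also have "\<dots> = (\<Sum>i<J. \<Sum>n=1..X. \<Sum>j<J. s (n + i * q) * s (n + j * q))" by (rule sum.swap)
  also have "\<dots> = (\<Sum>i<J. \<Sum>j<J. \<Sum>n=1..X. s (n + i * q) * s (n + j * q))"
    by (intro sum.cong refl sum.swap)
  also have "\<dots> \<le> (\<Sum>i<J. \<Sum>j<J. (if i = j then real X else R (nat \<bar>int i - int j\<bar>)) + 2 * real J * real q)"
    using pair by (intro sum_mono) auto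
  also have "\<dots> = (\<Sum>i<J. (\<Sum>j<J. if i = j then real X else R (nat \<bar>int i - int j\<bar>)) + real J * (2 * real J * real q))"
    by (simp add: sum.distrib)
  also have "\<dots> \<le> (\<Sum>i<J. (real X + 2 * (\<Sum>d=1..J. R d)) + real J * (2 * real J * real q))"
    by (intro sum_mono add_right_mono sum_differences_le R) auto
  also have "\<dots> = real J * (real X + 2 * (\<Sum>d=1..J. R d)) + 2 * real J ^ 3 * real q"
    by (simp add: algebra_simps power3_eq_cube)
  finally have Q: "(\<Sum>n=1..X. (\<Sum>j<J. s (n + j * q))\<^sup>2)
      \<le> real J * (real X + 2 * (\<Sum>d=1..J. R d)) + 2 * real J ^ 3 * real q" .
  have "D = (\<Sum>n=1..X. 1 * (\<Sum>j<J. s (n + j * q)))" by (simp add: D_def sum.swap[of _ "{..<J}"])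
  then have "D\<^sup>2 \<le> (\<Sum>n=1..X. 1\<^sup>2) * (\<Sum>n=1..X. (\<Sum>j<J. s (n + j * q))\<^sup>2)"
    using Cauchy_Schwarz_ineq_sum[of "\<lambda>_. 1" "\<lambda>n. \<Sum>j<J. s (n + j * q)" "{1..X}"] by simp
  also have "\<dots> \<le> real X * (real J * (real X + 2 * (\<Sum>d=1..J. R d)) + 2 * real J ^ 3 * real q)"
    using Q by (simp add: mult_left_mono)
  finally have "\<bar>D\<bar> \<le> sqrt (real X * (real J * (real X + 2 * (\<Sum>d=1..J. R d)) + 2 * real J ^ 3 * real q))"
    by (simp add: real_le_rsqrt)
  moreover have "real J * \<bar>S\<bar> = \<bar>real J * S\<bar>" by (simp add: abs_mult)
  ultimately show ?thesis using DS unfolding S_def by linarith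
qed

section \<open>The summatory function of the parity\<close>

definition prime_parity :: "nat \<Rightarrow> real" where
  "prime_parity n = (- 1) ^ card (primes_upto n)"

lemma abs_prime_parity [simp]: "\<bar>prime_parity n\<bar> = 1"
  by (simp add: prime_parity_def power_abs)

lemma card_primes_upto_add:
  "card (primes_upto (n + h)) = card (primes_upto n) + card (prime_window h (int n))"
proof (induction h)
  case 0
  then show ?case by (simp add: prime_window_def)
next
  case (Suc h)
  have iv: "{1..int (Suc h)} = insert (int (Suc h)) {1..int h}" by auto
  have pr: "prime (int n + int (Suc h)) \<longleftrightarrow> prime (Suc (n + h))"
    by (metis add_Suc_right of_nat_add prime_nat_int_transfer)
  have notin: "int (Suc h) \<notin> prime_window h (int n)" by (auto simp: prime_window_def)
  have "prime_window (Suc h) (int n) =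
      (if prime (Suc (n + h)) then insert (int (Suc h)) (prime_window h (int n)) else prime_window h (int n))"
    using pr unfolding prime_window_def iv by auto
  then show ?case using Suc notin by (simp add: primes_upto_Suc)
qed

lemma prime_parity_mult:
  "prime_parity n * prime_parity (n + h) = (- 1) ^ card (prime_window h (int n))"
  by (simp add: prime_parity_def card_primes_upto_add power_add mult.assoc[symmetric] flip: power_mult_distrib)

lemma sum_int_interval: "(\<Sum>n=1..X. f (int n)) = (\<Sum>n\<in>{1..int X}. f n)"
  by (rule sum.reindex_bij_witness[of _ nat int]) auto

text \<open>With \<open>L = ln (ln x)\<close> and \<open>q\<close> about \<open>ln x\<close>, the
  correlation at shift \<open>d * q\<close> is at most \<open>x * (1 / (2 d) + 1 / L ^ 4)\<close>.
  Using \<open>J\<close> about \<open>L ^ 3\<close> shifts, the squared mean is of order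
  \<open>ln L / L ^ 3\<close>. The exponent 5/4 is below 3/2, which leaves room for the logarithm,
  and above 1, which makes the later partial summation converge.\<close>

lemma prime_parity_sum_bound:
  assumes "quantitative_Hardy_Littlewood"
  shows "eventually (\<lambda>X. \<bar>\<Sum>n=1..X. prime_parity n\<bar> \<le> real X * ln (ln (real X)) powr (- 5/4)) sequentially"
proof -
  \<comment> \<open>Half of the claimed bound: one half is for the square root, the other for the
    error of shifting.\<close>
  let ?b = "\<lambda>x::real. ln (ln x) powr (- 5/4) / 2"
  have "eventually (\<lambda>x::real. ln x \<ge> 2) at_top" by real_asymp
  moreover have "eventually (\<lambda>x::real. ln (ln x) \<ge> 2) at_top" by real_asymp
  moreover have "eventually (\<lambda>x::real. (ln (ln x) ^ 3 + 1) * (ln x + 1) \<le> 2 * ln (ln x) ^ 3 * ln x) at_top"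
    by real_asymp
  moreover have "eventually (\<lambda>x::real. 2 * (ln (ln x) ^ 3 + 1) / ln (ln x) ^ 4 \<le> 1) at_top" by real_asymp
  moreover have "eventually (\<lambda>x::real. (3 + ln (ln (ln x) ^ 3 + 1)) / ln (ln x) ^ 3
      + 2 * (ln (ln x) ^ 3 + 1) * (ln x + 1) / x \<le> (?b x)\<^sup>2) at_top" by real_asymp
  moreover have "eventually (\<lambda>x::real. 2 * (ln (ln x) ^ 3 + 1) * (ln x + 1) \<le> x * ?b x) at_top" by real_asymp
  moreover have "eventually (\<lambda>x::real. x \<ge> 1) at_top" by (rule eventually_ge_at_top)
  moreover note parity_correlation_bound[OF assms]
  \<comment> \<open>Stated over real \<open>x\<close> with \<open>X\<close> tied to it by an
    equation, so that all asymptotic conditions share one filter before it is restricted to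
    integers.\<close>
  ultimately have "eventually (\<lambda>x::real. \<forall>X. x = real X \<longrightarrow>
      \<bar>\<Sum>n=1..X. prime_parity n\<bar> \<le> x * ln (ln x) powr (- 5/4)) at_top"
  proof eventually_elim
    case (elim x)
    show ?case
    proof (intro allI impI)
      fix X assume xX: "x = real X"
      define L where "L = ln (ln x)"
      define q where "q = nat \<lceil>ln x\<rceil>"
      define J where "J = nat \<lceil>L ^ 3\<rceil>"
      define S where "S = (\<Sum>n=1..X. prime_parity n)"
      have x0: "x > 0" using elim(7) by simp
      have L2: "L \<ge> 2" using elim(2) by (simp add: L_def)
      have L3: "L ^ 3 \<ge> 1" using L2 by (intro one_le_power) auto
      have q: "ln x \<le> real q" "real q \<le> ln x + 1" "q \<ge> 2" using elim(1) unfolding q_def by linarith+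
      have J: "L ^ 3 \<le> real J" "real J \<le> L ^ 3 + 1" "J \<ge> 1" using L3 unfolding J_def by linarith+
      define R where "R = (\<lambda>d. x * (1 / (2 * real d) + 1 / L ^ 4))"
      have R0: "R d \<ge> 0" for d using x0 L2 by (simp add: R_def)
      have corr: "\<bar>\<Sum>n=1..X. prime_parity n * prime_parity (n + d * q)\<bar> \<le> R d" if d: "1 \<le> d" "d \<le> J" for d
      proof -
        have "1 * 2 \<le> d * q" using d q(3) by (intro mult_le_mono) auto
        then have h2: "2 \<le> d * q" by simp
        have "real (d * q) \<le> (L ^ 3 + 1) * (ln x + 1)"
          using d J q L3 by (auto intro!: mult_mono)
        also have "\<dots> \<le> 2 * L ^ 3 * ln x" using elim(3) by (simp add: L_def)
        finally have hle: "real (d * q) \<le> 2 * ln (ln x) ^ 3 * ln x" by (simp add: L_def)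
        have "(\<Sum>n=1..X. prime_parity n * prime_parity (n + d * q))
            = (\<Sum>n\<in>{1..\<lfloor>x\<rfloor>}. (- 1) ^ card (prime_window (d * q) n))"
          using sum_int_interval[of "\<lambda>n. (- 1) ^ card (prime_window (d * q) n)" X]
          by (simp add: prime_parity_mult xX)
        also have "\<bar>\<dots>\<bar> \<le> x * (ln x / (2 * real (d * q)) + 1 / L ^ 4)"
          using elim(8) h2 hle by (simp only: L_def)
        also have "\<dots> \<le> R d" unfolding R_def
        proof (intro mult_left_mono add_right_mono)
          have "ln x / (2 * real (d * q)) \<le> real q / (2 * real (d * q))" using q by (intro divide_right_mono) auto
          also have "\<dots> = 1 / (2 * real d)" using q(3) by simp
          finally show "ln x / (2 * real (d * q)) \<le> 1 / (2 * real d)" .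
        qed (use x0 in auto)
        finally show ?thesis .
      qed
      have "real J * \<bar>S\<bar> \<le> sqrt (x * (real J * (x + 2 * (\<Sum>d=1..J. R d)) + 2 * real J ^ 3 * real q))
          + 2 * real J ^ 2 * real q"
        unfolding S_def xX by (rule van_der_Corput_bound[OF _ R0 corr]) auto
      also have "\<dots> \<le> real J * (x * ?b x) + real J * (x * ?b x)"
      proof (rule add_mono)
        have harm: "(\<Sum>d=1..J. 1 / real d) \<le> 1 + ln (real J)"
          using euler_mascheroni_sequence_decreasing[of 1 J] J(3)
          by (simp add: harm_def inverse_eq_divide)
        have "2 * (\<Sum>d=1..J. R d) = x * ((\<Sum>d=1..J. 1 / real d) + 2 * real J / L ^ 4)"
          by (simp add: R_def sum_distrib_left[symmetric] sum.distrib) (simp add: sum_divide_distrib[symmetric] sum_distrib_left algebra_simps)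
        also have "\<dots> \<le> x * ((1 + ln (real J)) + 1)"
        proof (intro mult_left_mono add_mono harm)
          have "2 * real J / L ^ 4 \<le> 2 * (L ^ 3 + 1) / L ^ 4" using J L2 by (intro divide_right_mono) auto
          then show "2 * real J / L ^ 4 \<le> 1" using elim(4) by (simp add: L_def)
        qed (use x0 in auto)
        finally have "x + 2 * (\<Sum>d=1..J. R d) \<le> x * (3 + ln (real J))" by (simp add: algebra_simps)
        then have "x * (real J * (x + 2 * (\<Sum>d=1..J. R d)) + 2 * real J ^ 3 * real q)
            \<le> x * (real J * (x * (3 + ln (real J))) + 2 * real J ^ 3 * real q)"
          using x0 by (intro mult_left_mono add_right_mono) auto
        also have "\<dots> = (real J * x)\<^sup>2 * ((3 + ln (real J)) / real J + 2 * real J * real q / x)"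
          using x0 J(3) by (simp add: field_simps power2_eq_square power3_eq_cube)
        also have "\<dots> \<le> (real J * x)\<^sup>2 * (?b x)\<^sup>2"
        proof (rule mult_left_mono)
          have lnJ: "ln (real J) \<le> ln (L ^ 3 + 1)"
            by (subst ln_le_cancel_iff) (use J L3 in linarith)+
          have "(3 + ln (real J)) / real J \<le> (3 + ln (L ^ 3 + 1)) / L ^ 3"
            using J L3 L2 by (intro frac_le add_left_mono add_nonneg_nonneg ln_ge_zero lnJ) auto
          moreover have "2 * real J * real q / x \<le> 2 * (L ^ 3 + 1) * (ln x + 1) / x"
            using J q x0 L3 by (intro divide_right_mono mult_mono) auto
          ultimately show "(3 + ln (real J)) / real J + 2 * real J * real q / x \<le> (?b x)\<^sup>2"
            using elim(5) by (simp add: L_def)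
        qed auto
        also have "\<dots> = (real J * (x * ?b x))\<^sup>2" by (simp only: power_mult_distrib mult.assoc)
        finally show "sqrt (x * (real J * (x + 2 * (\<Sum>d=1..J. R d)) + 2 * real J ^ 3 * real q)) \<le> real J * (x * ?b x)"
          using x0 by (intro real_le_lsqrt) auto
        have "2 * real J * real q \<le> 2 * (L ^ 3 + 1) * (ln x + 1)" using J q L3 by (intro mult_mono) auto
        also have "\<dots> \<le> x * ?b x" using elim(6) by (simp add: L_def)
        finally have "real J * (2 * real J * real q) \<le> real J * (x * ?b x)" by (intro mult_left_mono) auto
        then show "2 * real J ^ 2 * real q \<le> real J * (x * ?b x)" by (simp add: power2_eq_square mult_ac)
      qed
      also have "\<dots> = real J * (x * ln (ln x) powr (- 5/4))" by simp
      finally show "\<bar>\<Sum>n=1..X. prime_parity n\<bar> \<le> x * ln (ln x) powr (- 5/4)"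
        using J(3) by (simp add: S_def)
    qed
  qed
  then have "eventually (\<lambda>n. \<forall>X. real n = real X \<longrightarrow>
      \<bar>\<Sum>n=1..X. prime_parity n\<bar> \<le> real n * ln (ln (real n)) powr (- 5/4)) sequentially"
    by (rule eventually_compose_filterlim[OF _ filterlim_real_sequentially])
  then show ?thesis by eventually_elim auto
qed

section \<open>Partial summation against the parity\<close>

lemma summable_by_parts:
  fixes a g :: "nat \<Rightarrow> real"
  assumes "summable (\<lambda>n. (\<Sum>k<Suc n. a k) * (g n - g (Suc n)))"
    and "(\<lambda>n. (\<Sum>k<Suc n. a k) * g (Suc n)) \<longlonglongrightarrow> 0"
  shows "summable (\<lambda>n. a n * g n)"
proof -
  have eq: "(\<Sum>n<N. a n * g n) = (\<Sum>k<N. a k) * g N + (\<Sum>n<N. (\<Sum>k<Suc n. a k) * (g n - g (Suc n)))" for N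
    by (induction N) (auto simp: algebra_simps)
  have "(\<lambda>N. (\<Sum>k<N. a k) * g N) \<longlonglongrightarrow> 0" using assms(2) by (rule LIMSEQ_imp_Suc)
  moreover have "(\<lambda>N. \<Sum>n<N. (\<Sum>k<Suc n. a k) * (g n - g (Suc n)))
      \<longlonglongrightarrow> (\<Sum>n. (\<Sum>k<Suc n. a k) * (g n - g (Suc n)))"
    using assms(1) by (rule summable_LIMSEQ)
  ultimately have "(\<lambda>N. \<Sum>n<N. a n * g n) \<longlonglongrightarrow> 0 + (\<Sum>n. (\<Sum>k<Suc n. a k) * (g n - g (Suc n)))"
    unfolding eq by (rule tendsto_add)
  then show ?thesis by (auto simp: summable_def sums_def)
qed

text \<open>After summation by parts the terms are of size
  \<open>L powr (- 5/4) / (n * ln n)\<close> with \<open>L = ln (ln n)\<close>. This is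
  asymptotically four times the decrement of \<open>L powr (- 1/4)\<close>, so a telescoping series
  dominates.\<close>

lemma summable_prime_parity:
  assumes "quantitative_Hardy_Littlewood"
  shows "summable (\<lambda>n. prime_parity n * (1 / (real n * ln (real n))))"
proof (rule summable_by_parts)
  let ?g = "\<lambda>n. 1 / (real n * ln (real n))"
  let ?A = "\<lambda>n. \<Sum>k<Suc n. prime_parity k"
  let ?l = "\<lambda>n. ln (ln (real n))"
  have "eventually (\<lambda>n. 1 \<le> real n * ?l n powr (- 5/4)) sequentially" by real_asymp
  with prime_parity_sum_bound[OF assms]
  have A: "eventually (\<lambda>n. \<bar>?A n\<bar> \<le> 2 * (real n * ?l n powr (- 5/4))) sequentially"
  proof eventually_elim
    case (elim n)
    \<comment> \<open>The extra term at 0 has absolute value 1; the factor 2 in the bound absorbs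
      it.\<close>
    have "{..<Suc n} = insert 0 {1..n}" by auto
    then have "?A n = prime_parity 0 + (\<Sum>k=1..n. prime_parity k)" by (simp only:) simp
    then show ?case using elim abs_prime_parity[of 0] by linarith
  qed
  show "summable (\<lambda>n. ?A n * (?g n - ?g (Suc n)))"
  proof (rule summable_telescope_bound)
    show "(\<lambda>n. ?l n powr (- 1/4)) \<longlonglongrightarrow> 0" by real_asymp
    have "eventually (\<lambda>n. 1 / (real n * ln (real n)) - 1 / ((real n + 1) * ln (real n + 1)) \<ge> 0) sequentially"
      by real_asymp
    moreover have "eventually (\<lambda>n. 1 / (real n * ln (real n)) - 1 / ((real n + 1) * ln (real n + 1))
        \<le> 2 / ((real n)\<^sup>2 * ln (real n))) sequentially"
      by real_asymp
    moreover have "eventually (\<lambda>n. 4 * (?l n powr (- 5/4) / (real n * ln (real n)))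
        \<le> 32 * (?l n powr (- 1/4) - ln (ln (real n + 1)) powr (- 1/4))) sequentially"
      by real_asymp
    moreover note A eventually_gt_at_top[of 0]
    ultimately show "eventually (\<lambda>n. \<bar>?A n * (?g n - ?g (Suc n))\<bar>
        \<le> 32 * (?l n powr (- 1/4) - ?l (Suc n) powr (- 1/4))) sequentially"
    proof eventually_elim
      case (elim n)
      have S: "real (Suc n) = real n + 1" by simp
      have "\<bar>?A n * (?g n - ?g (Suc n))\<bar> = \<bar>?A n\<bar> * (?g n - ?g (Suc n))"
        using elim(1) by (simp only: abs_mult S abs_of_nonneg)
      also have "\<dots> \<le> (2 * (real n * ?l n powr (- 5/4))) * (2 / ((real n)\<^sup>2 * ln (real n)))"
        using elim(1,2,4) unfolding S by (intro mult_mono) auto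
      also have "\<dots> = 4 * (?l n powr (- 5/4) / (real n * ln (real n)))"
        using elim(5) by (simp add: power2_eq_square)
      also note elim(3)
      finally show ?case by (simp only: S)
    qed
  qed
  show "(\<lambda>n. ?A n * ?g (Suc n)) \<longlonglongrightarrow> 0"
  proof (rule Lim_null_comparison)
    show "(\<lambda>n. 2 * (real n * ?l n powr (- 5/4)) * (1 / ((real n + 1) * ln (real n + 1)))) \<longlonglongrightarrow> 0"
      by real_asymp
    show "eventually (\<lambda>n. norm (?A n * ?g (Suc n))
        \<le> 2 * (real n * ?l n powr (- 5/4)) * (1 / ((real n + 1) * ln (real n + 1)))) sequentially"
      using A
    proof eventually_elim
      case (elim n)
      have "norm (?A n * ?g (Suc n)) = \<bar>?A n\<bar> * (1 / ((real n + 1) * ln (real n + 1)))"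
        by (simp add: abs_mult add.commute)
      also have "\<dots> \<le> 2 * (real n * ?l n powr (- 5/4)) * (1 / ((real n + 1) * ln (real n + 1)))"
        using elim by (intro mult_right_mono) auto
      finally show ?case .
    qed
  qed
qed

text \<open>By the prime number theorem the weight is \<open>1 / (m * ln m)\<close> up to
  \<open>O(1 / (m * (ln m)^2))\<close>, and the latter converges absolutely.\<close>

lemma summable_prime_parity_ratio:
  assumes "quantitative_Hardy_Littlewood"
  shows "summable (\<lambda>m. prime_parity m * (real (card (primes_upto m)) / (real m * real (Suc m))))"
proof -
  let ?d = "\<lambda>m. real (card (primes_upto m)) / (real m * real (Suc m)) - 1 / (real m * ln (real m))"
  have "summable (\<lambda>m. prime_parity m * ?d m)"
  proof (rule summable_comparison_test_ev)
    show "summable (\<lambda>n. 5 * (1 / (real n * (ln (real n))\<^sup>2)))"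
      by (intro summable_mult summable_inverse_n_ln_squared)
    have "eventually (\<lambda>m. \<bar>1 / ((real m + 1) * ln (real m)) - 1 / (real m * ln (real m))\<bar>
        \<le> 1 / (real m * (ln (real m))\<^sup>2)) sequentially"
      by real_asymp
    with prime_count_ratio_error[OF assms]
    show "eventually (\<lambda>m. norm (prime_parity m * ?d m) \<le> 5 * (1 / (real m * (ln (real m))\<^sup>2))) sequentially"
    proof eventually_elim
      case (elim m)
      have "\<bar>u - w\<bar> \<le> 5 * e" if "\<bar>u - v\<bar> \<le> 4 * e" "\<bar>v - w\<bar> \<le> e" for u v w e :: real
        using that by linarith
      from this[OF elim] show ?case by (simp only: real_norm_def abs_mult abs_prime_parity mult_1)
    qed
  qed
  from summable_add[OF this summable_prime_parity[OF assms]] show ?thesis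
    by (simp add: algebra_simps)
qed

section \<open>The series over primes\<close>

text \<open>Summation over prime gaps controls only sums of two neighbouring terms of the
  alternating series. Up to boundary terms, the partial sums of \<open>t\<close> are half of those
  of the neighbour sums.\<close>

lemma summable_from_consecutive_sums:
  fixes t :: "nat \<Rightarrow> real"
  assumes "summable (\<lambda>k. t k + t (Suc k))" "t \<longlonglongrightarrow> 0"
  shows "summable t"
proof -
  have eq: "(\<Sum>k<N. t k) = ((\<Sum>k<N. t k + t (Suc k)) + t 0 - t N) / 2" for N
    by (induction N) (auto simp: field_simps)
  have "(\<lambda>N. \<Sum>k<N. t k) \<longlonglongrightarrow> ((\<Sum>k. t k + t (Suc k)) + t 0 - 0) / 2"
    unfolding eq by (intro tendsto_intros summable_LIMSEQ assms) auto
  then show ?thesis by (auto simp: summable_def sums_def)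
qed

text \<open>Counted from 0: \<open>prime_seq k\<close> is the prime with number
  \<open>Suc k\<close>, whence \<open>Suc k\<close> in the signs and numerators below.\<close>

abbreviation prime_seq :: "nat \<Rightarrow> nat" where
  "prime_seq \<equiv> enumerate {p::nat. prime p}"

lemma prime_seq_step: "prime_seq k < prime_seq (Suc k)"
  by (rule enumerate_step[OF primes_infinite])

lemma prime_seq_prime: "prime (prime_seq k)"
  using enumerate_in_set[OF primes_infinite, of k] by simp

lemma prime_seq_0: "prime_seq 0 = 2"
  unfolding enumerate_0 by (rule Least_equality) (auto dest: prime_ge_2_nat)

lemma filterlim_prime_seq: "filterlim prime_seq at_top sequentially"
  by (rule filterlim_subseq) (auto simp: strict_mono_def primes_infinite)

lemma card_primes_upto_between:
  assumes "prime_seq k \<le> m" "m < prime_seq (Suc k)"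
  shows "card (primes_upto m) = Suc k"
proof -
  have "primes_upto m = prime_seq ` {..k}"
  proof (intro equalityI subsetI)
    fix p assume "p \<in> primes_upto m"
    then have p: "prime p" "p \<le> m" by (auto simp: primes_upto_def)
    obtain j where j: "prime_seq j = p" using enumerate_Ex[OF primes_infinite, of p] p by auto
    then have "prime_seq j < prime_seq (Suc k)" using p assms by simp
    then have "j \<le> k" using primes_infinite by simp
    then show "p \<in> prime_seq ` {..k}" using j by auto
  next
    fix p assume "p \<in> prime_seq ` {..k}"
    then obtain j where j: "j \<le> k" "p = prime_seq j" by auto
    then have "prime_seq j \<le> prime_seq k" using primes_infinite by simp
    then show "p \<in> primes_upto m" using j assms prime_seq_prime[of j] by (simp add: primes_upto_def)
  qed
  moreover have "inj_on prime_seq {..k}"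
    by (rule inj_on_subset[OF inj_enumerate[OF primes_infinite]]) simp
  ultimately show ?thesis by (simp add: card_image)
qed

lemma sum_inverse_consecutive_products:
  assumes "a > 0" "a \<le> b"
  shows "(\<Sum>m\<in>{a..<b}. 1 / (real m * real (Suc m))) = 1 / real a - 1 / real b"
  using assms(2)
proof (induction b rule: dec_induct)
  case (step n)
  have "1 / (real n * real (Suc n)) = 1 / real n - 1 / real (Suc n)"
    using step assms(1) by (simp add: divide_simps)
  then show ?case using step by simp
qed simp


text \<open>From one prime up to the next the prime count is constantly \<open>Suc k\<close>, and
  \<open>1 / (m * (m + 1))\<close> telescopes. The result is arranged as a difference of consecutive
  quotients \<open>Suc k / prime_seq k\<close> plus a correction.\<close>

lemma sum_prime_parity_ratio_blocks:
  "(\<Sum>m<prime_seq N. prime_parity m * (real (card (primes_upto m)) / (real m * real (Suc m))))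
   = (\<Sum>k<N. (- 1) ^ Suc k * (real (Suc k) / real (prime_seq k) - real (Suc (Suc k)) / real (prime_seq (Suc k))
        + 1 / real (prime_seq (Suc k))))"
proof (induction N)
  case 0
  \<comment> \<open>There are no primes up to 0 or 1, so the terms before the first block
    vanish.\<close>
  have "{..<2::nat} = {0, 1}" by auto
  then show ?case by (simp add: prime_seq_0)
next
  case (Suc N)
  let ?b = "\<lambda>m. prime_parity m * (real (card (primes_upto m)) / (real m * real (Suc m)))"
  let ?p = "prime_seq N" and ?q = "prime_seq (Suc N)"
  have pq: "?p < ?q" by (rule prime_seq_step)
  have p0: "?p > 0" using prime_seq_prime[of N] by (simp add: prime_gt_0_nat)
  have "(\<Sum>m<?q. ?b m) = (\<Sum>m<?p. ?b m) + (\<Sum>m\<in>{?p..<?q}. ?b m)"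
    unfolding lessThan_atLeast0 by (rule sum.atLeastLessThan_concat[symmetric]) (use pq in simp_all)
  also have "(\<Sum>m\<in>{?p..<?q}. ?b m) = (\<Sum>m\<in>{?p..<?q}. ((- 1) ^ Suc N * real (Suc N)) * (1 / (real m * real (Suc m))))"
  proof (intro sum.cong refl)
    fix m assume "m \<in> {?p..<?q}"
    then have "card (primes_upto m) = Suc N" by (intro card_primes_upto_between) auto
    then show "?b m = ((- 1) ^ Suc N * real (Suc N)) * (1 / (real m * real (Suc m)))"
      by (simp add: prime_parity_def)
  qed
  also have "\<dots> = ((- 1) ^ Suc N * real (Suc N)) * (1 / real ?p - 1 / real ?q)"
    unfolding sum_distrib_left[symmetric] using pq p0 by (subst sum_inverse_consecutive_products) auto
  also have "\<dots> = (- 1) ^ Suc N * (real (Suc N) / real ?p - real (Suc (Suc N)) / real ?q + 1 / real ?q)"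
  proof -
    have "real (Suc N) * (1 / real ?p - 1 / real ?q) = real (Suc N) / real ?p - real (Suc (Suc N)) / real ?q + 1 / real ?q"
      by (simp add: right_diff_distrib add_divide_distrib)
    then show ?thesis by (simp only: mult.assoc)
  qed
  finally show ?case by (simp only: Suc.IH sum.lessThan_Suc)
qed

lemma prime_count_density_zero:
  assumes "quantitative_Hardy_Littlewood"
  shows "(\<lambda>n. real (card (primes_upto n)) / real n) \<longlonglongrightarrow> 0"
proof (rule Lim_null_comparison)
  show "(\<lambda>n. 1 / ln (real n) + 4 / (ln (real n))\<^sup>2) \<longlonglongrightarrow> 0" by real_asymp
  show "eventually (\<lambda>n. norm (real (card (primes_upto n)) / real n) \<le> 1 / ln (real n) + 4 / (ln (real n))\<^sup>2) sequentially"
    using prime_number_theorem_error[OF assms] eventually_gt_at_top[of 1]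
  proof eventually_elim
    case (elim n)
    have "real (card (primes_upto n)) \<le> real n / ln (real n) + 4 * real n / (ln (real n))\<^sup>2"
      using elim(1) by linarith
    also have "\<dots> = real n * (1 / ln (real n) + 4 / (ln (real n))\<^sup>2)" by (simp add: distrib_left)
    finally have "real (card (primes_upto n)) / real n \<le> 1 / ln (real n) + 4 / (ln (real n))\<^sup>2"
      using elim(2) by (simp add: divide_le_eq mult.commute)
    then show ?case by simp
  qed
qed

lemma summable_alternating_index_over_prime:
  assumes "quantitative_Hardy_Littlewood"
  shows "summable (\<lambda>k. (- 1) ^ Suc k * (real (Suc k) / real (prime_seq k)))"
proof (rule summable_from_consecutive_sums)
  let ?a = "\<lambda>k. real (Suc k) / real (prime_seq k)"
  have plim: "filterlim (\<lambda>k. real (prime_seq k)) at_top sequentially"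
    by (rule filterlim_compose[OF filterlim_real_sequentially filterlim_prime_seq])
  have "(\<lambda>k. real (card (primes_upto (prime_seq k))) / real (prime_seq k)) \<longlonglongrightarrow> 0"
    by (rule filterlim_compose[OF prime_count_density_zero[OF assms] filterlim_prime_seq])
  moreover have "card (primes_upto (prime_seq k)) = Suc k" for k
    by (rule card_primes_upto_between) (auto simp: prime_seq_step)
  ultimately have a0: "?a \<longlonglongrightarrow> 0" by simp
  show "(\<lambda>k. (- 1) ^ Suc k * ?a k) \<longlonglongrightarrow> 0"
  proof (rule Lim_null_comparison[OF _ a0])
    show "eventually (\<lambda>k. norm ((- 1) ^ Suc k * ?a k) \<le> ?a k) sequentially"
      by (simp add: abs_mult power_abs)
  qed
  let ?c = "\<lambda>k. (- 1) ^ Suc k * (?a k - ?a (Suc k) + 1 / real (prime_seq (Suc k)))"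
  \<comment> \<open>The partial sums of \<open>?c\<close> are those of the convergent parity series,
    cut off at the primes.\<close>
  have "(\<lambda>N. \<Sum>k<N. ?c k) \<longlonglongrightarrow>
      (\<Sum>m. prime_parity m * (real (card (primes_upto m)) / (real m * real (Suc m))))"
    unfolding sum_prime_parity_ratio_blocks[symmetric]
    by (rule filterlim_compose[OF summable_LIMSEQ[OF summable_prime_parity_ratio[OF assms]] filterlim_prime_seq])
  then have c: "summable ?c" by (auto simp: summable_def sums_def)
  \<comment> \<open>The correction terms alternate and decrease to 0; removing them from
    \<open>?c\<close> leaves exactly the neighbour sums.\<close>
  have "summable (\<lambda>k. (- 1) ^ k * (1 / real (prime_seq (Suc k))))"
  proof (rule summable_Leibniz'(1))
    have "(\<lambda>k. 1 / real (prime_seq k)) \<longlonglongrightarrow> 0"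
      using tendsto_inverse_0_at_top[OF plim] by (simp add: inverse_eq_divide)
    then show "(\<lambda>k. 1 / real (prime_seq (Suc k))) \<longlonglongrightarrow> 0" by (rule LIMSEQ_Suc)
    fix n
    show "1 / real (prime_seq (Suc (Suc n))) \<le> 1 / real (prime_seq (Suc n))"
      using prime_seq_step[of "Suc n"] prime_gt_0_nat[OF prime_seq_prime[of "Suc n"]]
      by (intro divide_left_mono) auto
  qed simp
  from summable_add[OF c this]
  have "summable (\<lambda>k. ?c k + (- 1) ^ k * (1 / real (prime_seq (Suc k))))" .
  moreover have "?c k + (- 1) ^ k * (1 / real (prime_seq (Suc k)))
      = (- 1) ^ Suc k * ?a k + (- 1) ^ Suc (Suc k) * ?a (Suc k)" for k
  proof -
    have "- u * (v - w + r) + u * r = - u * v + u * w" for u v w r :: real by (simp add: algebra_simps)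
    from this[of "(- 1) ^ k"] show ?thesis by (simp only: power_Suc mult_minus1 minus_minus)
  qed
  ultimately show "summable (\<lambda>k. (- 1) ^ Suc k * ?a k + (- 1) ^ Suc (Suc k) * ?a (Suc k))"
    by (simp only:)
qed

theorem theorem1p4:
  assumes "quantitative_Hardy_Littlewood"
  shows "summable (\<lambda>n. (- 1) ^ prime_pi (real (n + 2)) / (real (n + 2) * ln (real (n + 2))))
       \<and> summable (\<lambda>n. (- 1) ^ (n + 1) * real (n + 1) / real (nth_prime (n + 1)))"
proof
  have "summable (\<lambda>n. prime_parity (n + 2) * (1 / (real (n + 2) * ln (real (n + 2)))))"
    using summable_prime_parity[OF assms] by (subst summable_iff_shift)
  then show "summable (\<lambda>n. (- 1) ^ prime_pi (real (n + 2)) / (real (n + 2) * ln (real (n + 2))))"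
    unfolding prime_parity_def prime_pi_nat by simp
  show "summable (\<lambda>n. (- 1) ^ (n + 1) * real (n + 1) / real (nth_prime (n + 1)))"
    using summable_alternating_index_over_prime[OF assms] by (simp add: nth_prime_def)
qed

end
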